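(* Let $a\in\Omega$. There is a cutted cone $\mathscr C=\mathscr C_a(\alpha,r)$ (with some $\alpha\in(0,1)$ and $r>0$) such that every $u\in\mathscr S_a$ is differentiable on $\mathscr C$ (i.e. differentiable at each point of $\mathscr C$).
   Context: Setting: $E$ is a Euclidean space of finite dimension $d\ge 2$, $N\ge 2$, and $m_1,\dots,m_N>0$ are masses. For $x=(r_1,\dots,r_N)\in E^N$, $U(x)=\sum_{i<j}m_im_j\|r_i-r_j\|_E^{-1}$ (with value $+\infty$ at collisions), and $\Omega=\{x\in E^N: r_i\ne r_j\ \forall i\neq j\}$. $E^N$ carries the mass inner product $\langle (r_i),(s_i)\rangle=\sum_i m_i\langle r_i,s_i\rangle_E$, with norm $\|\cdot\|$; gradients are taken with respect to it. A motion is a solution $x:I\to\Omega$ of $\ddot x=\nabla U(x)$; its energy $\frac12\|\dot x\|^2-U(x)$ is constant. A hyperbolic motion is a motion defined on an interval unbounded to the right with $x(t)=ta+o(t)$ as $t\to+\infty$ for some $a\in\Omega$; $a$ is called its limit shape (its energy is then $\frac12\|a\|^2$). For $h\ge 0$ and an absolutely continuous curve $\gamma:[s_0,s_1]\to E^N$, $\mathcal A_{L+h}(\gamma)=\int_{s_0}^{s_1}\big(\frac12\|\dot\gamma\|^2+U(\gamma)+h\big)dt\in[0,+\infty]$. A function $u:E^N\to\mathbb R$ is dominated by $L+h$ if $u(\gamma(s_1))-u(\gamma(s_0))\le\mathcal A_{L+h}(\gamma)$ for every absolutely continuous $\gamma:[s_0,s_1]\to E^N$. For such $u$, an absolutely continuous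 curve $\gamma:I\to E^N$ calibrates $u$ if $u(\gamma(s_1))-u(\gamma(s_0))=\mathcal A_{L+h}(\gamma|_{[s_0,s_1]})$ for every $[s_0,s_1]\subset I$. For $a\in\Omega$ and $h=\frac12\|a\|^2$, $\mathscr S_a$ is the set of hyperbolic viscosity solutions of $\frac12\|\nabla u\|^2-U=h$ with limit shape $a$, i.e. of continuous $u:E^N\to\mathbb R$ such that (i) $u$ is dominated by $L+h$; (ii) for every $x\in E^N$ there is at least one curve $\gamma_x:(-\infty,0]\to E^N$ with $\gamma_x(0)=x$ calibrating $u$; (iii) every curve $\gamma:(-\infty,0]\to E^N$ calibrating $u$ is, after time reversal $t\mapsto\gamma(-t)$ (on $t>0$), a hyperbolic motion with limit shape $a$. Cones: for $\alpha\in(0,1)$ and $r>0$, $\mathscr C_a(\alpha)=\{x\in E^N:\langle x,a\rangle\ge\alpha\|x\|\|a\|\}$ and the cutted cone is $\mathscr C_a(\alpha,r)=\{x\in\mathscr C_a(\alpha):\|x\|\ge r\}$. *)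

theory Defs
  imports
    "HOL-Analysis.Analysis"
    "HOL-Library.Landau_Symbols"
begin

text \<open>
  The configuration space \<open>E^N\<close> is the type \<open>'e ^ 'n\<close>, where \<open>'e\<close> is the Euclidean space \<open>E\<close>
  and \<open>'n\<close> is the finite, linearly ordered set of labels of the \<open>N\<close> bodies; it is written
  \<open>('e, 'n) vec\<close> because the infix notation would constrain \<open>'n\<close> to the bare sort \<open>finite\<close>.
  The built-in norm of this type is not the mass norm but is equivalent to it; it is used only
  where the choice between equivalent norms is irrelevant (continuity, differentiability, absolute
  continuity).
\<close>

definition mass_inner :: "('n::finite \<Rightarrow> real) \<Rightarrow> ('e::euclidean_space, 'n) vec \<Rightarrow> ('e, 'n) vec \<Rightarrow> real" where
  "mass_inner m x y = (\<Sum>i\<in>UNIV. m i * ((x $ i) \<bullet> (y $ i)))"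

definition mass_norm :: "('n::finite \<Rightarrow> real) \<Rightarrow> ('e::euclidean_space, 'n) vec \<Rightarrow> real" where
  "mass_norm m x = sqrt (mass_inner m x x)"

definition collision_free :: "('e::euclidean_space, 'n::finite) vec set" where
  "collision_free = {x. \<forall>i j. i \<noteq> j \<longrightarrow> x $ i \<noteq> x $ j}"

text \<open>
  The Newtonian potential as a real function, meaningful only on \<^const>\<open>collision_free\<close>
  (division by zero yields zero), and its extension by \<open>+\<infinity>\<close> to collisions.
\<close>

definition newton_potential ::
    "('n::{finite,linorder} \<Rightarrow> real) \<Rightarrow> ('e::euclidean_space, 'n) vec \<Rightarrow> real" where
  "newton_potential m x = (\<Sum>(i,j)\<in>{(i,j). i < j}. m i * m j / norm (x $ i - x $ j))"

definition newton_potential_ext ::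
    "('n::{finite,linorder} \<Rightarrow> real) \<Rightarrow> ('e::euclidean_space, 'n) vec \<Rightarrow> ennreal" where
  "newton_potential_ext m x =
    (if x \<in> collision_free then ennreal (newton_potential m x) else \<infinity>)"

definition has_mass_gradient ::
    "('n::finite \<Rightarrow> real) \<Rightarrow> (('e::euclidean_space, 'n) vec \<Rightarrow> real) \<Rightarrow> ('e, 'n) vec \<Rightarrow> ('e, 'n) vec \<Rightarrow> bool" where
  "has_mass_gradient m f g x \<longleftrightarrow> (f has_derivative (\<lambda>v. mass_inner m g v)) (at x)"

definition is_motion ::
    "('n::{finite,linorder} \<Rightarrow> real) \<Rightarrow> real set \<Rightarrow> (real \<Rightarrow> ('e::euclidean_space, 'n) vec) \<Rightarrow> bool" where
  "is_motion m I x \<longleftrightarrow>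
    is_interval I \<and>
    (\<exists>v w. \<forall>t\<in>I. x t \<in> collision_free \<and>
       (x has_vector_derivative v t) (at t within I) \<and>
       (v has_vector_derivative w t) (at t within I) \<and>
       has_mass_gradient m (newton_potential m) (w t) (x t))"

definition is_hyperbolic_motion ::
    "('n::{finite,linorder} \<Rightarrow> real) \<Rightarrow> ('e::euclidean_space, 'n) vec \<Rightarrow> real set
      \<Rightarrow> (real \<Rightarrow> ('e, 'n) vec) \<Rightarrow> bool" where
  "is_hyperbolic_motion m a I x \<longleftrightarrow>
    a \<in> collision_free \<and> is_motion m I x \<and> \<not> bdd_above I \<and>
    (\<lambda>t. mass_norm m (x t - t *\<^sub>R a)) \<in> o[at_top](\<lambda>t. t)"

definition abs_continuous_on :: "real \<Rightarrow> real \<Rightarrow> (real \<Rightarrow> 'b::metric_space) \<Rightarrow> bool" where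
  "abs_continuous_on s0 s1 \<gamma> \<longleftrightarrow>
    (\<forall>\<epsilon>>0. \<exists>\<delta>>0. \<forall>P. finite P \<and> (\<forall>(p,q)\<in>P. s0 \<le> p \<and> p \<le> q \<and> q \<le> s1) \<and>
       disjoint_family_on (\<lambda>(p,q). {p<..<q}) P \<and> (\<Sum>(p,q)\<in>P. q - p) < \<delta>
       \<longrightarrow> (\<Sum>(p,q)\<in>P. dist (\<gamma> p) (\<gamma> q)) < \<epsilon>)"

text \<open>
  An absolutely continuous curve is differentiable almost everywhere, so the arbitrary value of
  \<^const>\<open>vector_derivative\<close> at the other points does not affect the integral.
\<close>

definition action ::
    "('n::{finite,linorder} \<Rightarrow> real) \<Rightarrow> real \<Rightarrow> real \<Rightarrow> real
      \<Rightarrow> (real \<Rightarrow> ('e::euclidean_space, 'n) vec) \<Rightarrow> ennreal" where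
  "action m h s0 s1 \<gamma> =
    (\<integral>\<^sup>+t\<in>{s0..s1}.
       (ennreal ((mass_norm m (vector_derivative \<gamma> (at t within {s0..s1})))\<^sup>2 / 2)
         + newton_potential_ext m (\<gamma> t) + ennreal h) \<partial>lborel)"

definition dominated ::
    "('n::{finite,linorder} \<Rightarrow> real) \<Rightarrow> real \<Rightarrow> (('e::euclidean_space, 'n) vec \<Rightarrow> real) \<Rightarrow> bool" where
  "dominated m h u \<longleftrightarrow>
    (\<forall>s0 s1 \<gamma>. s0 \<le> s1 \<and> abs_continuous_on s0 s1 \<gamma>
       \<longrightarrow> ereal (u (\<gamma> s1) - u (\<gamma> s0)) \<le> enn2ereal (action m h s0 s1 \<gamma>))"

text \<open>On a non-compact interval, absolute continuity means absolute continuity on each compact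
  subinterval.\<close>

definition calibrates ::
    "('n::{finite,linorder} \<Rightarrow> real) \<Rightarrow> real \<Rightarrow> (('e::euclidean_space, 'n) vec \<Rightarrow> real) \<Rightarrow> real set
      \<Rightarrow> (real \<Rightarrow> ('e, 'n) vec) \<Rightarrow> bool" where
  "calibrates m h u I \<gamma> \<longleftrightarrow>
    (\<forall>s0 s1. s0 \<le> s1 \<and> {s0..s1} \<subseteq> I \<longrightarrow>
       abs_continuous_on s0 s1 \<gamma> \<and>
       ereal (u (\<gamma> s1) - u (\<gamma> s0)) = enn2ereal (action m h s0 s1 \<gamma>))"

definition hyperbolic_viscosity_solutions ::
    "('n::{finite,linorder} \<Rightarrow> real) \<Rightarrow> ('e::euclidean_space, 'n) vec \<Rightarrow> (('e, 'n) vec \<Rightarrow> real) set" where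
  "hyperbolic_viscosity_solutions m a =
    (let h = (mass_norm m a)\<^sup>2 / 2 in
      {u. continuous_on UNIV u \<and> dominated m h u \<and>
          (\<forall>x. \<exists>\<gamma>. \<gamma> 0 = x \<and> calibrates m h u {..0} \<gamma>) \<and>
          (\<forall>\<gamma>. calibrates m h u {..0} \<gamma> \<longrightarrow>
             is_hyperbolic_motion m a {0<..} (\<lambda>t. \<gamma> (- t)))})"

definition mass_cone ::
    "('n::finite \<Rightarrow> real) \<Rightarrow> ('e::euclidean_space, 'n) vec \<Rightarrow> real \<Rightarrow> ('e, 'n) vec set" where
  "mass_cone m a \<alpha> = {x. mass_inner m x a \<ge> \<alpha> * mass_norm m x * mass_norm m a}"

definition cutted_cone ::
    "('n::finite \<Rightarrow> real) \<Rightarrow> ('e::euclidean_space, 'n) vec \<Rightarrow> real \<Rightarrow> real \<Rightarrow> ('e, 'n) vec set" where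
  "cutted_cone m a \<alpha> r = {x \<in> mass_cone m a \<alpha>. mass_norm m x \<ge> r}"

end

theory Submission
  imports Defs
begin

text \<open>
  Run backwards in time, a calibrating curve of \<open>u\<close> ending at \<open>y\<close> is a motion \<open>x\<close> that starts at
  \<open>y\<close> and escapes in the direction \<open>a\<close>; as long as it is in a sector around \<open>a\<close> at axial
  distance at least \<open>\<rho>\<close>, its velocity is within \<open>O(1/\<rho>)\<close> of \<open>a\<close>. If \<open>y\<close> lies in a narrower
  cutted cone, then \<open>x\<close> never leaves the sector. Indeed, if \<open>x s\<close> is the last point on its boundary, then
  comparing \<open>x\<close> after time \<open>s\<close> with its translate that starts at \<open>y\<close> (the translation
  being undone slowly) gives \<open>u y - u (x s) \<le> \<langle>a, d\<rangle> + O(1/\<rho>) \<parallel>d\<parallel>\<close> for \<open>d = x s - y\<close>,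
  whereas the action of \<open>x\<close> up to time \<open>s\<close> is at least \<open>\<parallel>a\<parallel> \<parallel>d\<parallel>\<close>; hence \<open>d\<close> points
  into a narrow cone around \<open>a\<close>, and \<open>x s = y + d\<close> is an interior point of the sector.

  Since the forces decay like \<open>(\<rho> + t/2)\<^sup>-\<^sup>2\<close> along such motions and their derivatives like
  \<open>(\<rho> + t/2)\<^sup>-\<^sup>3\<close>, the initial velocity is a Lipschitz function of the starting point. The first
  variation bounds \<open>u (y + \<delta>) - u y\<close> from above by a linear function given by the initial velocity
  plus \<open>O(\<parallel>\<delta>\<parallel>\<^sup>2)\<close>. Exchanging the roles of \<open>y\<close> and \<open>y + \<delta>\<close> gives the matching lower bound.
\<close>

section \<open>The Newtonian potential at separated configurations\<close>

lemma inverse_norm_lipschitz: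
  fixes p q :: "'a::real_inner"
  assumes "0 < \<mu>" "\<mu> \<le> norm p" "\<mu> \<le> norm q"
  shows "\<bar>1 / norm p - 1 / norm q\<bar> \<le> norm (p - q) / \<mu>\<^sup>2"
proof -
  have pq: "0 < norm p" "0 < norm q" using assms by linarith+
  have "\<bar>1 / norm p - 1 / norm q\<bar> = \<bar>norm q - norm p\<bar> / (norm p * norm q)"
  proof -
    have "1 / norm p - 1 / norm q = (norm q - norm p) / (norm p * norm q)"
      using pq by (simp add: diff_divide_distrib)
    then show ?thesis by (simp add: abs_mult)
  qed
  also have "\<dots> \<le> norm (p - q) / \<mu>\<^sup>2"
    using assms norm_triangle_ineq3[of q p]
    by (intro frac_le) (auto simp: power2_eq_square norm_minus_commute intro!: mult_mono)
  finally show ?thesis .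
qed

text \<open>Up to sign the expression is the differential of \<open>1 / norm\<close> in direction
  \<open>v\<close>. Changing the vector in the numerator costs 1 in the constant, and changing the
  cubed norm in the denominator costs 3.\<close>

lemma inverse_norm_derivative_lipschitz:
  fixes p q v :: "'a::real_inner"
  assumes "0 < \<mu>" "\<mu> \<le> norm p" "\<mu> \<le> norm q"
  shows "\<bar>(p \<bullet> v) / norm p ^ 3 - (q \<bullet> v) / norm q ^ 3\<bar> \<le> 4 * norm (p - q) * norm v / \<mu> ^ 3"
proof -
  let ?P = "norm p" and ?Q = "norm q"
  have pq: "0 < ?P" "0 < ?Q" using assms by linarith+
  have le1: "1 / (?P ^ 3) \<le> 1 / \<mu> ^ 3"
    using assms by (intro frac_le power_mono) auto
  have le2: "1 / (?P\<^sup>2 * ?Q) \<le> 1 / \<mu> ^ 3"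
    using assms pq unfolding power3_eq_cube power2_eq_square
    by (intro divide_left_mono) (auto intro!: mult_mono)
  have le3: "1 / (?P * ?Q\<^sup>2) \<le> 1 / \<mu> ^ 3"
    using assms pq unfolding power3_eq_cube power2_eq_square mult.assoc
    by (intro divide_left_mono) (auto intro!: mult_mono)
  have tri: "\<bar>?Q - ?P\<bar> \<le> norm (p - q)"
    using norm_triangle_ineq3[of q p] by (simp add: norm_minus_commute)
  have "(p \<bullet> v) / ?P ^ 3 - (q \<bullet> v) / ?Q ^ 3
      = ((p - q) \<bullet> v) * (1 / ?P ^ 3) + (q \<bullet> v) * (1 / ?P ^ 3 - 1 / ?Q ^ 3)"
    by (simp add: inner_diff_left diff_divide_distrib right_diff_distrib)
  \<comment> \<open>The factor \<open>1 / ?Q\<close> is kept apart so that it cancels the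
    \<open>?Q\<close> that Cauchy-Schwarz produces from \<open>q \<bullet> v\<close>.\<close>
  also have "1 / ?P ^ 3 - 1 / ?Q ^ 3
      = (?Q - ?P) / ?Q * (1 / ?P ^ 3 + 1 / (?P\<^sup>2 * ?Q) + 1 / (?P * ?Q\<^sup>2))"
    using pq by (simp add: field_simps power2_eq_square power3_eq_cube)
  finally have "\<bar>(p \<bullet> v) / ?P ^ 3 - (q \<bullet> v) / ?Q ^ 3\<bar>
      \<le> \<bar>(p - q) \<bullet> v\<bar> * (1 / ?P ^ 3)
        + \<bar>q \<bullet> v\<bar> * (\<bar>?Q - ?P\<bar> / ?Q * (1 / ?P ^ 3 + 1 / (?P\<^sup>2 * ?Q) + 1 / (?P * ?Q\<^sup>2)))"
    using pq by (simp add: abs_mult order_trans[OF abs_triangle_ineq])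
  also have "\<dots> \<le> (norm (p - q) * norm v) * (1 / \<mu> ^ 3)
        + (?Q * norm v) * (norm (p - q) / ?Q * (1 / \<mu> ^ 3 + 1 / \<mu> ^ 3 + 1 / \<mu> ^ 3))"
    using assms pq le1 le2 le3 tri Cauchy_Schwarz_ineq2[of "p - q" v] Cauchy_Schwarz_ineq2[of q v]
    by (intro add_mono mult_mono divide_right_mono) auto
  also have "\<dots> = 4 * norm (p - q) * norm v / \<mu> ^ 3"
    using pq by simp
  finally show ?thesis .
qed

text \<open>Algebra replaces Taylor's formula, because the segment from \<open>p\<close> to
  \<open>q\<close> may pass close to the origin, where second derivatives are not controlled.
  Nonnegativity of the square of \<open>q - p\<close> bounds the linear term by the two norms, and
  what remains is an explicit multiple of the squared difference of the norms.\<close>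

lemma inverse_norm_taylor:
  fixes p q :: "'a::real_inner"
  assumes "0 < \<mu>" "\<mu> \<le> norm p" "\<mu> \<le> norm q"
  shows "1 / norm q - 1 / norm p + (p \<bullet> (q - p)) / norm p ^ 3 \<le> 3 / 2 * (norm (p - q))\<^sup>2 / \<mu> ^ 3"
proof -
  let ?P = "norm p" and ?Q = "norm q"
  have pq: "0 < ?P" "0 < ?Q" using assms by linarith+
  have le1: "1 / (?P ^ 3) \<le> 1 / \<mu> ^ 3"
    using assms by (intro frac_le power_mono) auto
  have le2: "1 / (?P\<^sup>2 * ?Q) \<le> 1 / \<mu> ^ 3"
    using assms pq unfolding power3_eq_cube power2_eq_square
    by (intro divide_left_mono) (auto intro!: mult_mono)
  have tri: "(?Q - ?P)\<^sup>2 \<le> (norm (p - q))\<^sup>2"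
    using norm_triangle_ineq3[of q p]
    by (metis abs_le_square_iff abs_norm_cancel norm_minus_commute)
  have "p \<bullet> (q - p) \<le> (?Q\<^sup>2 - ?P\<^sup>2) / 2"
    using inner_ge_zero[of "q - p"]
    unfolding power2_norm_eq_inner by (simp add: inner_diff inner_commute)
  then have "1 / ?Q - 1 / ?P + (p \<bullet> (q - p)) / ?P ^ 3
      \<le> 1 / ?Q - 1 / ?P + ((?Q\<^sup>2 - ?P\<^sup>2) / 2) / ?P ^ 3"
    using pq by (intro add_left_mono divide_right_mono) auto
  also have "\<dots> = (?Q - ?P)\<^sup>2 * (1 / 2 * (1 / ?P ^ 3) + 1 / (?P\<^sup>2 * ?Q))"
    using pq by (simp add: field_simps power2_eq_square power3_eq_cube)
  also have "\<dots> \<le> (norm (p - q))\<^sup>2 * (1 / 2 * (1 / \<mu> ^ 3) + 1 / \<mu> ^ 3)"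
    using le1 le2 tri pq assms
    by (intro mult_mono add_mono) auto
  also have "\<dots> = 3 / 2 * (norm (p - q))\<^sup>2 / \<mu> ^ 3" by simp
  finally show ?thesis .
qed

section \<open>Summation over pairs: the potential and its differential\<close>

definition pair_separated :: "real \<Rightarrow> ('e::euclidean_space, 'n::finite) vec \<Rightarrow> bool" where
  "pair_separated \<mu> x \<longleftrightarrow> (\<forall>i j. i \<noteq> j \<longrightarrow> \<mu> \<le> norm (x $ i - x $ j))"

text \<open>The differential of the potential as a linear form in \<open>v\<close>; in this form the
  estimates do not involve the mass inner product.\<close>

definition potential_deriv ::
    "('n::{finite,linorder} \<Rightarrow> real) \<Rightarrow> ('e::euclidean_space, 'n) vec \<Rightarrow> ('e, 'n) vec \<Rightarrow> real" where
  "potential_deriv m x v = (\<Sum>(i,j)\<in>{(i,j). i < j}.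
     - (m i * m j * (((x $ i - x $ j) \<bullet> (v $ i - v $ j)) / norm (x $ i - x $ j) ^ 3)))"

lemma norm_pair_le:
  fixes v :: "('e::euclidean_space, 'n::finite) vec"
  shows "norm (v $ i - v $ j) \<le> 2 * norm v"
  using norm_triangle_ineq4[of "v $ i" "v $ j"] Finite_Cartesian_Product.norm_nth_le[of v i] Finite_Cartesian_Product.norm_nth_le[of v j] by linarith

lemma newton_potential_has_derivative:
  fixes x :: "('e::euclidean_space, 'n::{finite,linorder}) vec"
  assumes "x \<in> collision_free"
  shows "(newton_potential m has_derivative potential_deriv m x) (at x)"
proof -
  have "((\<lambda>x. m i * m j / norm (x $ i - x $ j)) has_derivative
      (\<lambda>v. - (m i * m j * (((x $ i - x $ j) \<bullet> (v $ i - v $ j)) / norm (x $ i - x $ j) ^ 3)))) (at x)"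
    if "i < j" for i j
  proof -
    have ne: "x $ i - x $ j \<noteq> 0" using assms that by (auto simp: collision_free_def)
    have "((\<lambda>x. norm (x $ i - x $ j)) has_derivative
        (\<lambda>v. (v $ i - v $ j) \<bullet> sgn (x $ i - x $ j))) (at x)"
      by (rule has_derivative_compose[where f = "\<lambda>x. x $ i - x $ j" and g = norm, OF _ has_derivative_norm[OF ne]])
        (intro derivative_intros bounded_linear.has_derivative[OF bounded_linear_vec_nth])
    note D = has_derivative_divide[OF has_derivative_const this, of "m i * m j"]
    have "- k * (inverse (norm p) * (w \<bullet> sgn p) * inverse (norm p)) + 0 / norm p
        = - (k * ((p \<bullet> w) / norm p ^ 3))" for k :: real and p w :: 'e
      by (simp add: sgn_div_norm inner_commute divide_inverse power3_eq_cube mult_ac)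
    then show ?thesis
      by (intro has_derivative_eq_rhs[OF D]) (use ne in \<open>simp_all add: fun_eq_iff\<close>)
  qed
  then show ?thesis
    unfolding newton_potential_def[abs_def] potential_deriv_def[abs_def]
    by (intro has_derivative_sum) auto
qed

lemma has_derivative_quadratic_remainder:
  fixes f :: "'a::real_normed_vector \<Rightarrow> real"
  assumes D: "bounded_linear D"
    and rem: "eventually (\<lambda>h. \<bar>f (x + h) - f x - D h\<bar> \<le> C * (norm h)\<^sup>2) (at 0)"
  shows "(f has_derivative D) (at x)"
  unfolding has_derivative_at
proof (intro conjI D)
  have lim: "((\<lambda>h::'a. C * norm h) \<longlongrightarrow> 0) (at 0)"
    by (rule tendsto_mult_right_zero[OF tendsto_norm_zero[OF tendsto_ident_at]])
  show "(\<lambda>h. norm (f (x + h) - f x - D h) / norm h) \<midarrow>0\<rightarrow> 0"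
  proof (rule tendsto_sandwich[OF _ _ tendsto_const lim])
    show "\<forall>\<^sub>F h in at 0. norm (f (x + h) - f x - D h) / norm h \<le> C * norm h"
      using rem by eventually_elim (auto simp: divide_le_eq power2_eq_square mult.assoc)
  qed simp
qed

locale newton_masses =
  fixes m :: "'n::{finite,linorder} \<Rightarrow> real"
  assumes m_pos: "\<And>i. 0 < m i"
begin

lemma newton_potential_nonneg: "0 \<le> newton_potential m x"
  unfolding newton_potential_def using m_pos by (intro sum_nonneg) (auto simp: less_imp_le)

definition pair_mass :: real where
  "pair_mass = (\<Sum>(i,j)\<in>{(i,j). i < j}. m i * m j)"

lemma sum_pairs_bound:
  assumes "\<And>i j. i < j \<Longrightarrow> f i j \<le> m i * m j * B"
  shows "(\<Sum>(i,j)\<in>{(i,j). i < j}. f i j) \<le> pair_mass * B"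
  unfolding pair_mass_def sum_distrib_right using assms by (intro sum_mono) auto

lemma pair_mass_nonneg: "0 \<le> pair_mass"
  unfolding pair_mass_def using m_pos by (intro sum_nonneg) (auto simp: less_imp_le)

lemma newton_potential_lipschitz:
  assumes "0 < \<mu>" "pair_separated \<mu> x" "pair_separated \<mu> y"
  shows "newton_potential m x - newton_potential m y \<le> pair_mass * (2 * norm (x - y) / \<mu>\<^sup>2)"
proof -
  have "newton_potential m x - newton_potential m y
      = (\<Sum>(i,j)\<in>{(i,j). i < j}. m i * m j * (1 / norm (x $ i - x $ j) - 1 / norm (y $ i - y $ j)))"
    unfolding newton_potential_def sum_subtractf[symmetric]
    by (intro sum.cong) (auto simp: algebra_simps)
  also have "\<dots> \<le> pair_mass * (2 * norm (x - y) / \<mu>\<^sup>2)"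
  proof (intro sum_pairs_bound mult_left_mono)
    fix i j :: 'n assume "i < j"
    then have "\<bar>1 / norm (x $ i - x $ j) - 1 / norm (y $ i - y $ j)\<bar>
        \<le> norm ((x $ i - x $ j) - (y $ i - y $ j)) / \<mu>\<^sup>2"
      using assms by (intro inverse_norm_lipschitz) (auto simp: pair_separated_def)
    also have "\<dots> \<le> 2 * norm (x - y) / \<mu>\<^sup>2"
      using norm_pair_le[of "x - y" i j] assms
      by (intro divide_right_mono) (auto simp: algebra_simps)
    finally show "1 / norm (x $ i - x $ j) - 1 / norm (y $ i - y $ j) \<le> 2 * norm (x - y) / \<mu>\<^sup>2"
      by linarith
  qed (use m_pos in \<open>auto simp: less_imp_le\<close>)
  finally show ?thesis .
qed

text \<open>An upper bound suffices: \<open>v\<close> is arbitrary and will later be the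
  acceleration itself.\<close>

lemma potential_deriv_bound:
  assumes "0 < \<mu>" "pair_separated \<mu> x"
  shows "potential_deriv m x v \<le> pair_mass * (2 * norm v / \<mu>\<^sup>2)"
  unfolding potential_deriv_def
proof (intro sum_pairs_bound)
  fix i j :: 'n assume "i < j"
  then have sep: "\<mu> \<le> norm (x $ i - x $ j)" using assms by (auto simp: pair_separated_def)
  let ?p = "x $ i - x $ j" and ?v = "v $ i - v $ j"
  have p: "0 < norm ?p" using sep assms by linarith
  have "- ((?p \<bullet> ?v) / norm ?p ^ 3) \<le> (norm ?p * norm ?v) / norm ?p ^ 3"
    using Cauchy_Schwarz_ineq2[of ?p ?v] p
    unfolding minus_divide_left by (intro divide_right_mono) auto
  also have "\<dots> = norm ?v / (norm ?p)\<^sup>2"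
    using p by (simp add: power2_eq_square power3_eq_cube)
  also have "\<dots> \<le> 2 * norm v / \<mu>\<^sup>2"
    using sep assms by (intro frac_le norm_pair_le power_mono) auto
  finally show "- (m i * m j * ((?p \<bullet> ?v) / norm ?p ^ 3)) \<le> m i * m j * (2 * norm v / \<mu>\<^sup>2)"
    using mult_left_mono[of "- ((?p \<bullet> ?v) / norm ?p ^ 3)" "2 * norm v / \<mu>\<^sup>2" "m i * m j"]
      m_pos by (simp add: less_imp_le)
qed

lemma potential_deriv_lipschitz:
  assumes "0 < \<mu>" "pair_separated \<mu> x" "pair_separated \<mu> y"
  shows "potential_deriv m x v - potential_deriv m y v
    \<le> pair_mass * (16 * norm (x - y) * norm v / \<mu> ^ 3)"
proof -
  have "potential_deriv m x v - potential_deriv m y v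
      = (\<Sum>(i,j)\<in>{(i,j). i < j}. m i * m j *
          (((y $ i - y $ j) \<bullet> (v $ i - v $ j)) / norm (y $ i - y $ j) ^ 3
          - ((x $ i - x $ j) \<bullet> (v $ i - v $ j)) / norm (x $ i - x $ j) ^ 3))"
    unfolding potential_deriv_def sum_subtractf[symmetric]
    by (intro sum.cong) (auto simp: algebra_simps)
  also have "\<dots> \<le> pair_mass * (16 * norm (x - y) * norm v / \<mu> ^ 3)"
  proof (intro sum_pairs_bound mult_left_mono)
    fix i j :: 'n assume "i < j"
    then have "\<bar>((y $ i - y $ j) \<bullet> (v $ i - v $ j)) / norm (y $ i - y $ j) ^ 3
          - ((x $ i - x $ j) \<bullet> (v $ i - v $ j)) / norm (x $ i - x $ j) ^ 3\<bar>
        \<le> 4 * norm ((y $ i - y $ j) - (x $ i - x $ j)) * norm (v $ i - v $ j) / \<mu> ^ 3"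
      using assms by (intro inverse_norm_derivative_lipschitz) (auto simp: pair_separated_def)
    also have "\<dots> \<le> 4 * (2 * norm (x - y)) * (2 * norm v) / \<mu> ^ 3"
      using norm_pair_le[of "y - x" i j] norm_pair_le[of v i j] assms
      by (intro divide_right_mono mult_mono) (auto simp: algebra_simps norm_minus_commute)
    finally show "((y $ i - y $ j) \<bullet> (v $ i - v $ j)) / norm (y $ i - y $ j) ^ 3
          - ((x $ i - x $ j) \<bullet> (v $ i - v $ j)) / norm (x $ i - x $ j) ^ 3
        \<le> 16 * norm (x - y) * norm v / \<mu> ^ 3"
      by simp
  qed (use m_pos in \<open>auto simp: less_imp_le\<close>)
  finally show ?thesis .
qed

text \<open>Only the upper side of the remainder is controlled; this is the side needed to bound the
  action of a competitor from above.\<close>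

lemma newton_potential_taylor:
  assumes "0 < \<mu>" "pair_separated \<mu> x" "pair_separated \<mu> y"
  shows "newton_potential m y - newton_potential m x - potential_deriv m x (y - x)
    \<le> pair_mass * (6 * (norm (x - y))\<^sup>2 / \<mu> ^ 3)"
proof -
  have "newton_potential m y - newton_potential m x - potential_deriv m x (y - x)
      = (\<Sum>(i,j)\<in>{(i,j). i < j}. m i * m j *
          (1 / norm (y $ i - y $ j) - 1 / norm (x $ i - x $ j)
          + ((x $ i - x $ j) \<bullet> ((y $ i - y $ j) - (x $ i - x $ j))) / norm (x $ i - x $ j) ^ 3))"
    unfolding potential_deriv_def newton_potential_def sum_subtractf[symmetric]
    by (intro sum.cong) (auto simp: algebra_simps)
  also have "\<dots> \<le> pair_mass * (6 * (norm (x - y))\<^sup>2 / \<mu> ^ 3)"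
  proof (intro sum_pairs_bound mult_left_mono)
    fix i j :: 'n assume "i < j"
    then have "1 / norm (y $ i - y $ j) - 1 / norm (x $ i - x $ j)
          + ((x $ i - x $ j) \<bullet> ((y $ i - y $ j) - (x $ i - x $ j))) / norm (x $ i - x $ j) ^ 3
        \<le> 3 / 2 * (norm ((x $ i - x $ j) - (y $ i - y $ j)))\<^sup>2 / \<mu> ^ 3"
      using assms by (intro inverse_norm_taylor) (auto simp: pair_separated_def)
    also have "\<dots> \<le> 3 / 2 * (2 * norm (x - y))\<^sup>2 / \<mu> ^ 3"
      using norm_pair_le[of "x - y" i j] assms
      by (intro divide_right_mono mult_left_mono power_mono) (auto simp: algebra_simps)
    finally show "1 / norm (y $ i - y $ j) - 1 / norm (x $ i - x $ j)
          + ((x $ i - x $ j) \<bullet> ((y $ i - y $ j) - (x $ i - x $ j))) / norm (x $ i - x $ j) ^ 3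
        \<le> 6 * (norm (x - y))\<^sup>2 / \<mu> ^ 3"
      by (simp add: power_mult_distrib)
  qed (use m_pos in \<open>auto simp: less_imp_le\<close>)
  finally show ?thesis .
qed

end

section \<open>The mass norm and sectors around the limit shape\<close>

text \<open>An isometry from the mass inner product to the built-in one, through which the Hilbert
  space facts about the latter are transferred.\<close>

definition mass_scale :: "('n::finite \<Rightarrow> real) \<Rightarrow> ('e::euclidean_space, 'n) vec \<Rightarrow> ('e, 'n) vec" where
  "mass_scale m x = (\<chi> i. sqrt (m i) *\<^sub>R x $ i)"

lemma linear_mass_scale: "linear (mass_scale m)"
  by (rule linearI) (simp_all add: mass_scale_def vec_eq_iff scaleR_right_distrib mult.commute)

context newton_masses
begin

lemma mass_inner_scale: "mass_inner m x y = mass_scale m x \<bullet> mass_scale m y"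
proof -
  have *: "sqrt (m i) * (sqrt (m i) * c) = m i * c" for i c
    using m_pos[of i] by (simp add: mult.assoc[symmetric] abs_of_pos del: mult.assoc)
  show ?thesis by (simp add: mass_inner_def mass_scale_def inner_vec_def *)
qed

lemma mass_norm_scale: "mass_norm m x = norm (mass_scale m x)"
  by (simp add: mass_norm_def mass_inner_scale norm_eq_sqrt_inner)

lemma inj_mass_scale: "inj (mass_scale m)"
proof -
  have "m i \<noteq> 0" for i using m_pos[of i] by simp
  then show ?thesis by (auto simp: inj_on_def mass_scale_def vec_eq_iff)
qed

lemmas mass_scale_simps =
  linear_add[OF linear_mass_scale] linear_diff[OF linear_mass_scale]
  linear_scale[OF linear_mass_scale] linear_neg[OF linear_mass_scale] linear_0[OF linear_mass_scale]

lemma mass_norm_nonneg [simp]: "0 \<le> mass_norm m x"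
  by (simp add: mass_norm_scale)

lemma mass_norm_zero [simp]: "mass_norm m 0 = 0"
  by (simp add: mass_norm_scale mass_scale_simps)

lemma mass_norm_eq_zero_iff: "mass_norm m x = 0 \<longleftrightarrow> x = 0"
  using inj_mass_scale linear_injective_0[OF linear_mass_scale] mass_norm_zero
  by (auto simp: mass_norm_scale)

lemma mass_norm_scaleR: "mass_norm m (c *\<^sub>R x) = \<bar>c\<bar> * mass_norm m x"
  by (simp add: mass_norm_scale mass_scale_simps)

lemma mass_norm_minus [simp]: "mass_norm m (- x) = mass_norm m x"
  by (simp add: mass_norm_scale mass_scale_simps)

lemma mass_norm_minus_commute: "mass_norm m (x - y) = mass_norm m (y - x)"
  by (simp add: mass_norm_scale mass_scale_simps norm_minus_commute)

lemma mass_norm_triangle: "mass_norm m (x + y) \<le> mass_norm m x + mass_norm m y"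
  by (simp add: mass_norm_scale mass_scale_simps norm_triangle_ineq)

lemma mass_norm_triangle_diff: "mass_norm m (x - y) \<le> mass_norm m x + mass_norm m y"
  by (simp add: mass_norm_scale mass_scale_simps norm_triangle_ineq4)

lemma mass_norm_square: "(mass_norm m x)\<^sup>2 = mass_inner m x x"
  by (simp add: mass_norm_scale mass_inner_scale power2_norm_eq_inner)

lemma mass_inner_le: "mass_inner m x y \<le> mass_norm m x * mass_norm m y"
  by (simp add: mass_norm_scale mass_inner_scale norm_cauchy_schwarz)

lemma abs_mass_inner_le: "\<bar>mass_inner m x y\<bar> \<le> mass_norm m x * mass_norm m y"
  by (simp add: mass_norm_scale mass_inner_scale Cauchy_Schwarz_ineq2)

lemma mass_inner_commute: "mass_inner m x y = mass_inner m y x"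
  by (simp add: mass_inner_scale inner_commute)

lemma mass_inner_linear:
  "mass_inner m (x + y) z = mass_inner m x z + mass_inner m y z"
  "mass_inner m (x - y) z = mass_inner m x z - mass_inner m y z"
  "mass_inner m (c *\<^sub>R x) z = c * mass_inner m x z"
  "mass_inner m (- x) z = - mass_inner m x z"
  "mass_inner m z (x + y) = mass_inner m z x + mass_inner m z y"
  "mass_inner m z (x - y) = mass_inner m z x - mass_inner m z y"
  "mass_inner m z (c *\<^sub>R x) = c * mass_inner m z x"
  "mass_inner m z (- x) = - mass_inner m z x"
  by (simp_all add: mass_inner_scale mass_scale_simps inner_add inner_diff)

lemma mass_norm_diff_square:
  "(mass_norm m (x - y))\<^sup>2 = (mass_norm m x)\<^sup>2 - 2 * mass_inner m x y + (mass_norm m y)\<^sup>2"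
  by (simp add: mass_norm_square mass_inner_linear mass_inner_commute[of y x])

lemma bounded_linear_mass_scale: "bounded_linear (mass_scale m)"
  using linear_mass_scale by (simp add: linear_conv_bounded_linear)

lemma bounded_bilinear_mass_inner: "bounded_bilinear (mass_inner m)"
proof -
  have "bounded_bilinear (\<lambda>x y. mass_scale m x \<bullet> mass_scale m y)"
    using bounded_bilinear.comp[OF bounded_bilinear_inner bounded_linear_mass_scale bounded_linear_mass_scale] .
  then show ?thesis by (simp add: mass_inner_scale[abs_def])
qed

lemma continuous_on_mass_norm: "continuous_on S (mass_norm m)"
proof -
  have "continuous_on S (\<lambda>x. norm (mass_scale m x))"
    by (intro continuous_intros linear_continuous_on bounded_linear_mass_scale)
  then show ?thesis by (simp add: mass_norm_scale[abs_def])
qed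

lemma mass_norm_equivalent:
  obtains c1 c2 where "0 < c1" "0 < c2"
    "\<And>x::('e::euclidean_space, 'n) vec. mass_norm m x \<le> c1 * norm x"
    "\<And>x::('e::euclidean_space, 'n) vec. norm x \<le> c2 * mass_norm m x"
proof -
  obtain c where c: "0 < c" "\<And>x::('e, 'n) vec. norm (mass_scale m x) \<le> c * norm x"
    using linear_bounded_pos[OF linear_mass_scale] by blast
  obtain b where b: "0 < b" "\<And>x::('e, 'n) vec. b * norm x \<le> norm (mass_scale m x)"
    using linear_inj_bounded_below_pos[OF linear_mass_scale inj_mass_scale] by blast
  show thesis
    by (rule that[of c "1 / b"]) (use b c in \<open>auto simp: mass_norm_scale field_simps\<close>)
qed

text \<open>The speed is compared with the derivative of a function \<open>g\<close> rather than
  with a constant, so that decaying bounds can be integrated by naming an antiderivative.\<close>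

lemma mass_norm_mean_value:
  fixes f :: "real \<Rightarrow> ('e::euclidean_space, 'n) vec"
  assumes "s \<le> t" "continuous_on {s..t} f" "continuous_on {s..t} g"
    and "\<And>r. s < r \<Longrightarrow> r < t \<Longrightarrow> (f has_vector_derivative f' r) (at r)"
    and "\<And>r. s < r \<Longrightarrow> r < t \<Longrightarrow> (g has_vector_derivative g' r) (at r)"
    and "\<And>r. s < r \<Longrightarrow> r < t \<Longrightarrow> mass_norm m (f' r) \<le> g' r"
  shows "mass_norm m (f t - f s) \<le> g t - g s"
proof (cases "s = t")
  case False
  have "norm (mass_scale m (f t) - mass_scale m (f s)) \<le> g t - g s"
    using assms False
    by (intro differentiable_bound_general[where f' = "\<lambda>r. mass_scale m (f' r)" and \<phi>' = g']
        linear_continuous_on_compose[OF _ linear_mass_scale]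
        bounded_linear.has_vector_derivative[OF bounded_linear_mass_scale])
      (auto simp: mass_norm_scale[symmetric])
  then show ?thesis by (simp add: mass_norm_scale mass_scale_simps)
qed simp

end

section \<open>Coordinates along and across the limit shape\<close>

locale newton_shape = newton_masses m
  for m :: "'n::{finite,linorder} \<Rightarrow> real" +
  fixes a :: "('e::euclidean_space, 'n) vec"
  assumes several_bodies: "CARD('n) \<ge> 2"
    and a_collision_free: "a \<in> collision_free"
begin

definition speed :: real where
  "speed = mass_norm m a"

text \<open>The orthogonal projection to the line of \<open>a\<close>, measured in multiples of
  \<open>a\<close>: at \<open>t *\<^sub>R a\<close> the value is \<open>t\<close>.\<close>

definition axial :: "('e, 'n) vec \<Rightarrow> real" where
  "axial x = mass_inner m x a / speed\<^sup>2"

definition radial :: "('e, 'n) vec \<Rightarrow> real" where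
  "radial x = mass_norm m (x - axial x *\<^sub>R a)"

text \<open>A solid cone about the ray of \<open>a\<close>, without its apex. Since
  \<open>radial\<close> is a mass norm and \<open>axial\<close> a multiple of \<open>a\<close>,
  \<kappa> is \<open>speed\<close> times the tangent of the half-angle.\<close>

definition sector :: "real \<Rightarrow> ('e, 'n) vec set" where
  "sector \<kappa> = {x. 0 < axial x \<and> radial x \<le> \<kappa> * axial x}"

lemma speed_pos: "0 < speed"
proof -
  obtain i j :: 'n where "i \<noteq> j"
    using several_bodies card_le_Suc0_iff_eq[of "UNIV :: 'n set"] by force
  then have "a $ i \<noteq> a $ j" using a_collision_free by (auto simp: collision_free_def)
  then have "a \<noteq> 0" by auto
  then show ?thesis
    unfolding speed_def using mass_norm_eq_zero_iff mass_norm_nonneg by (metis less_eq_real_def)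
qed

lemma mass_inner_axial: "mass_inner m x a = speed\<^sup>2 * axial x"
  using speed_pos by (simp add: axial_def)

lemma axial_linear:
  "axial (x + y) = axial x + axial y"
  "axial (x - y) = axial x - axial y"
  "axial (c *\<^sub>R x) = c * axial x"
  by (simp_all add: axial_def mass_inner_linear add_divide_distrib diff_divide_distrib)

lemma axial_a [simp]: "axial a = 1"
  using speed_pos by (simp add: axial_def mass_norm_square[symmetric] speed_def[symmetric])

lemma abs_axial_le: "\<bar>axial x\<bar> \<le> mass_norm m x / speed"
  using abs_mass_inner_le[of x a] speed_pos
  by (simp add: axial_def speed_def[symmetric] power2_eq_square field_simps)

lemma radial_nonneg [simp]: "0 \<le> radial x"
  by (simp add: radial_def)

lemma radial_add: "radial (x + y) \<le> radial x + radial y"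
  using mass_norm_triangle[of "x - axial x *\<^sub>R a" "y - axial y *\<^sub>R a"]
  by (simp add: radial_def axial_linear algebra_simps)

lemma radial_scaleR: "radial (c *\<^sub>R x) = \<bar>c\<bar> * radial x"
  using mass_norm_scaleR[of c "x - axial x *\<^sub>R a"]
  by (simp add: radial_def axial_linear scaleR_diff_right)

lemma pythagoras: "(mass_norm m x)\<^sup>2 = (radial x)\<^sup>2 + (axial x)\<^sup>2 * speed\<^sup>2"
proof -
  have "mass_inner m a a = speed\<^sup>2" using mass_inner_axial[of a] by simp
  then show ?thesis
    unfolding radial_def mass_norm_square
    by (simp add: mass_inner_linear mass_inner_commute[of a x] mass_inner_axial axial_linear
        power2_eq_square algebra_simps)
qed

text \<open>Drift along \<open>a\<close> does not change \<open>radial\<close>, and the remaining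
  projection orthogonal to \<open>a\<close> does not increase the norm.\<close>

lemma radial_le: "radial (x + c *\<^sub>R a) \<le> mass_norm m x"
proof -
  have "radial (x + c *\<^sub>R a) = radial x"
    by (simp add: radial_def axial_linear algebra_simps)
  also have "\<dots> \<le> mass_norm m x"
  proof (rule power2_le_imp_le)
    show "(radial x)\<^sup>2 \<le> (mass_norm m x)\<^sup>2" unfolding pythagoras by simp
  qed simp
  finally show ?thesis .
qed

lemma continuous_on_axial: "continuous_on S f \<Longrightarrow> continuous_on S (\<lambda>x. axial (f x))"
  unfolding axial_def
  by (rule continuous_on_divide[OF bounded_bilinear.continuous_on[OF bounded_bilinear_mass_inner]])
    (use speed_pos in auto)

lemma continuous_on_radial: "continuous_on S f \<Longrightarrow> continuous_on S (\<lambda>x. radial (f x))"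
  unfolding radial_def
  by (intro continuous_on_compose2[OF continuous_on_mass_norm[of UNIV]] continuous_intros continuous_on_axial) auto

lemma isCont_axial: "isCont x t \<Longrightarrow> isCont (\<lambda>t. axial (x t)) t"
proof -
  assume x: "isCont x t"
  have "continuous_on UNIV (\<lambda>y. axial y)" by (rule continuous_on_axial[OF continuous_on_id])
  then have "isCont axial (x t)" by (simp add: continuous_on_eq_continuous_at)
  with x show "isCont (\<lambda>t. axial (x t)) t" by (rule isCont_o2)
qed

lemma isCont_radial: "isCont x t \<Longrightarrow> isCont (\<lambda>t. radial (x t)) t"
proof -
  assume x: "isCont x t"
  have "continuous_on UNIV (\<lambda>y. radial y)" by (rule continuous_on_radial[OF continuous_on_id])
  then have "isCont radial (x t)" by (simp add: continuous_on_eq_continuous_at)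
  with x show "isCont (\<lambda>t. radial (x t)) t" by (rule isCont_o2)
qed

lemma sector_mono: "x \<in> sector \<kappa> \<Longrightarrow> \<kappa> \<le> \<kappa>' \<Longrightarrow> x \<in> sector \<kappa>'"
  by (auto simp: sector_def intro: order_trans mult_right_mono)

text \<open>Translates the cosine \<alpha> of the theorem's cone into a slope: by Pythagoras,
  \<open>radial\<close> over \<open>axial\<close> is at most \<open>speed\<close> times the tangent
  \<open>sqrt (1 / \<alpha>\<^sup>2 - 1)\<close>. The last claim converts a lower bound on the norm
  into one on the axial distance.\<close>

lemma mass_cone_radial:
  assumes "x \<in> mass_cone m a \<alpha>" "0 < \<alpha>"
  shows "0 \<le> axial x" "(radial x)\<^sup>2 \<le> (axial x)\<^sup>2 * (speed\<^sup>2 * (1 / \<alpha>\<^sup>2 - 1))"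
    "\<alpha> * mass_norm m x \<le> speed * axial x"
proof -
  have "\<alpha> * mass_norm m x * speed \<le> speed\<^sup>2 * axial x"
    using assms by (simp add: mass_cone_def speed_def[symmetric] mass_inner_axial)
  then show *: "\<alpha> * mass_norm m x \<le> speed * axial x"
    using speed_pos by (simp add: power2_eq_square mult.commute mult.left_commute)
  then have "0 \<le> speed * axial x"
    using assms(2) mass_norm_nonneg[of x] by (meson mult_nonneg_nonneg less_imp_le order_trans)
  then show "0 \<le> axial x" using speed_pos by (simp add: zero_le_mult_iff)
  have "(\<alpha> * mass_norm m x)\<^sup>2 \<le> (speed * axial x)\<^sup>2"
    using * assms(2) by (intro power_mono) auto
  then have "(mass_norm m x)\<^sup>2 \<le> (speed * axial x)\<^sup>2 / \<alpha>\<^sup>2"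
    using assms(2) by (simp add: field_simps power_mult_distrib)
  then show "(radial x)\<^sup>2 \<le> (axial x)\<^sup>2 * (speed\<^sup>2 * (1 / \<alpha>\<^sup>2 - 1))"
    using pythagoras[of x] by (simp add: algebra_simps power_mult_distrib)
qed

text \<open>The pairwise distances of \<open>axial x *\<^sub>R a\<close> grow linearly with
  \<open>axial x\<close>, and in a narrow sector the deviation of \<open>x\<close> from this
  multiple destroys at most half of them.\<close>

lemma sector_pair_separated:
  obtains \<kappa> c where "0 < \<kappa>" "0 < c" "\<And>x. x \<in> sector \<kappa> \<Longrightarrow> pair_separated (c * axial x) x"
proof -
  let ?S = "(\<lambda>(i,j). norm (a $ i - a $ j)) ` {(i,j). i \<noteq> j}"
  \<comment> \<open>The inserted 1 makes the finite set visibly nonempty.\<close>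
  define c where "c = Min (insert 1 ?S)"
  have c: "0 < c" using a_collision_free by (auto simp: c_def collision_free_def)
  have cle: "c \<le> norm (a $ i - a $ j)" if "i \<noteq> j" for i j
    unfolding c_def using that by (intro Min_le) auto
  obtain c1 c2 where c2: "0 < c2" "\<And>x::('e, 'n) vec. norm x \<le> c2 * mass_norm m x"
    using mass_norm_equivalent by metis
  \<comment> \<open>Chosen so that the deviation has built-in norm at most
    \<open>c / 4 * axial x\<close>; a difference of two of its components then costs at most
    \<open>c / 2 * axial x\<close>.\<close>
  define \<kappa> where "\<kappa> = c / (4 * c2)"
  show thesis
  proof (rule that[of \<kappa> "c / 2"])
    fix x assume x: "x \<in> sector \<kappa>"
    let ?e = "x - axial x *\<^sub>R a"
    have "norm ?e \<le> c2 * radial x" using c2 by (simp add: radial_def)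
    also have "\<dots> \<le> c2 * (\<kappa> * axial x)" using x c2 by (auto simp: sector_def)
    also have "\<dots> = c / 4 * axial x" using c2 by (simp add: \<kappa>_def)
    finally have e: "norm ?e \<le> c / 4 * axial x" .
    show "pair_separated (c / 2 * axial x) x"
      unfolding pair_separated_def
    proof (intro allI impI)
      fix i j :: 'n assume ij: "i \<noteq> j"
      have "axial x * c \<le> axial x * norm (a $ i - a $ j)"
        using cle[OF ij] x by (auto simp: sector_def)
      also have "\<dots> = norm (axial x *\<^sub>R (a $ i - a $ j))" using x by (auto simp: sector_def)
      also have "\<dots> = norm ((x $ i - x $ j) - (?e $ i - ?e $ j))" by (simp add: algebra_simps)
      also have "\<dots> \<le> norm (x $ i - x $ j) + norm (?e $ i - ?e $ j)" by (rule norm_triangle_ineq4)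
      finally show "c / 2 * axial x \<le> norm (x $ i - x $ j)"
        using norm_pair_le[of ?e i j] e by (simp add: mult.commute)
    qed
  qed (use c c2 in \<open>auto simp: \<kappa>_def\<close>)
qed

end

text \<open>One constant \<open>K\<close> in mass norms for all decay estimates at axial distance at
  least \<mu>. The powers of \<mu> are those of the first and second derivatives of a potential
  homogeneous of degree -1.\<close>

locale newton_sector = newton_shape m a
  for m :: "'n::{finite,linorder} \<Rightarrow> real" and a :: "('e::euclidean_space, 'n) vec" +
  fixes \<kappa> K :: real
  assumes \<kappa>_pos: "0 < \<kappa>" and K_pos: "0 < K"
    and sector_collision_free: "sector \<kappa> \<subseteq> collision_free"
    and potential_lip: "\<And>x y \<mu>. \<lbrakk>0 < \<mu>; x \<in> sector \<kappa>; y \<in> sector \<kappa>; \<mu> \<le> axial x; \<mu> \<le> axial y\<rbrakk> \<Longrightarrow>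
        newton_potential m x - newton_potential m y \<le> K * mass_norm m (x - y) / \<mu>\<^sup>2"
    and force_bound: "\<And>x v \<mu>. \<lbrakk>0 < \<mu>; x \<in> sector \<kappa>; \<mu> \<le> axial x\<rbrakk> \<Longrightarrow>
        potential_deriv m x v \<le> K * mass_norm m v / \<mu>\<^sup>2"
    and force_lip: "\<And>x y v \<mu>. \<lbrakk>0 < \<mu>; x \<in> sector \<kappa>; y \<in> sector \<kappa>; \<mu> \<le> axial x; \<mu> \<le> axial y\<rbrakk> \<Longrightarrow>
        potential_deriv m x v - potential_deriv m y v
          \<le> K * mass_norm m (x - y) * mass_norm m v / \<mu> ^ 3"
    and potential_taylor: "\<And>x y \<mu>. \<lbrakk>0 < \<mu>; x \<in> sector \<kappa>; y \<in> sector \<kappa>; \<mu> \<le> axial x; \<mu> \<le> axial y\<rbrakk> \<Longrightarrow>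
        newton_potential m y - newton_potential m x - potential_deriv m x (y - x)
          \<le> K * (mass_norm m (x - y))\<^sup>2 / \<mu> ^ 3"

context newton_shape
begin

lemma sector_estimates:
  obtains \<kappa> K where "newton_sector m a \<kappa> K"
proof -
  obtain \<kappa> c where \<kappa>: "0 < \<kappa>" and c: "0 < c" and sep: "\<And>x. x \<in> sector \<kappa> \<Longrightarrow> pair_separated (c * axial x) x"
    using sector_pair_separated by metis
  obtain c1 b where b: "0 < b" "\<And>x::('e, 'n) vec. norm x \<le> b * mass_norm m x"
    using mass_norm_equivalent by metis
  \<comment> \<open>The added 1 makes \<open>K\<close> strictly positive, given only
    \<open>pair_mass_nonneg\<close>.\<close>
  let ?P = "pair_mass + 1"
  have P: "0 < ?P" using pair_mass_nonneg by linarith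
  \<comment> \<open>The first entry serves both the Lipschitz bound of the potential and the force
    bound, the second the Lipschitz bound of the force, the third the Taylor remainder.\<close>
  define K where "K = max (max (?P * (2 * b / c\<^sup>2)) (?P * (16 * b * b / c ^ 3))) (?P * (6 * b\<^sup>2 / c ^ 3))"
  have K: "?P * (2 * b / c\<^sup>2) \<le> K" "?P * (16 * b * b / c ^ 3) \<le> K" "?P * (6 * b\<^sup>2 / c ^ 3) \<le> K"
    by (simp_all add: K_def)
  have "0 < ?P * (2 * b / c\<^sup>2)" using P b c by simp
  with K(1) have K0: "0 < K" by linarith
  have sep': "pair_separated (c * \<mu>) x" if "x \<in> sector \<kappa>" "\<mu> \<le> axial x" for x \<mu>
  proof -
    have "c * \<mu> \<le> c * axial x" using that c by simp
    then show ?thesis using sep[OF that(1)] order_trans by (fastforce simp: pair_separated_def)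
  qed
  show thesis
  proof (rule that, unfold_locales)
    show "0 < \<kappa>" "0 < K" by fact+
    show "sector \<kappa> \<subseteq> collision_free"
    proof
      fix x assume x: "x \<in> sector \<kappa>"
      then have "0 < c * axial x" using c by (simp add: sector_def)
      with sep[OF x] show "x \<in> collision_free"
        by (fastforce simp: collision_free_def pair_separated_def)
    qed
  next
    fix x y \<mu> assume *: "(0::real) < \<mu>" "x \<in> sector \<kappa>" "y \<in> sector \<kappa>" "\<mu> \<le> axial x" "\<mu> \<le> axial y"
    have "newton_potential m x - newton_potential m y \<le> pair_mass * (2 * norm (x - y) / (c * \<mu>)\<^sup>2)"
      using * c sep' by (intro newton_potential_lipschitz) auto
    also have "\<dots> \<le> ?P * (2 * (b * mass_norm m (x - y)) / (c * \<mu>)\<^sup>2)"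
      using b c * pair_mass_nonneg by (intro mult_mono divide_right_mono) auto
    also have "\<dots> = (?P * (2 * b / c\<^sup>2)) * (mass_norm m (x - y) / \<mu>\<^sup>2)"
      by (simp add: power_mult_distrib)
    also have "\<dots> \<le> K * (mass_norm m (x - y) / \<mu>\<^sup>2)"
      using K(1) by (rule mult_right_mono) simp
    finally show "newton_potential m x - newton_potential m y \<le> K * mass_norm m (x - y) / \<mu>\<^sup>2" by simp
  next
    fix x v \<mu> assume *: "(0::real) < \<mu>" "x \<in> sector \<kappa>" "\<mu> \<le> axial x"
    have "potential_deriv m x v \<le> pair_mass * (2 * norm v / (c * \<mu>)\<^sup>2)"
      using * c sep' by (intro potential_deriv_bound) auto
    also have "\<dots> \<le> ?P * (2 * (b * mass_norm m v) / (c * \<mu>)\<^sup>2)"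
      using b c * pair_mass_nonneg by (intro mult_mono divide_right_mono) auto
    also have "\<dots> = (?P * (2 * b / c\<^sup>2)) * (mass_norm m v / \<mu>\<^sup>2)"
      by (simp add: power_mult_distrib)
    also have "\<dots> \<le> K * (mass_norm m v / \<mu>\<^sup>2)"
      using K(1) by (rule mult_right_mono) simp
    finally show "potential_deriv m x v \<le> K * mass_norm m v / \<mu>\<^sup>2" by simp
  next
    fix x y v \<mu> assume *: "(0::real) < \<mu>" "x \<in> sector \<kappa>" "y \<in> sector \<kappa>" "\<mu> \<le> axial x" "\<mu> \<le> axial y"
    have "potential_deriv m x v - potential_deriv m y v
        \<le> pair_mass * (16 * norm (x - y) * norm v / (c * \<mu>) ^ 3)"
      using * c sep' by (intro potential_deriv_lipschitz) auto
    also have "\<dots> \<le> ?P * (16 * (b * mass_norm m (x - y)) * (b * mass_norm m v) / (c * \<mu>) ^ 3)"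
      using b c * pair_mass_nonneg by (intro mult_mono divide_right_mono) auto
    also have "\<dots> = (?P * (16 * b * b / c ^ 3)) * (mass_norm m (x - y) * mass_norm m v / \<mu> ^ 3)"
      by (simp add: power_mult_distrib)
    also have "\<dots> \<le> K * (mass_norm m (x - y) * mass_norm m v / \<mu> ^ 3)"
      using K(2) by (rule mult_right_mono) (use * in simp)
    finally show "potential_deriv m x v - potential_deriv m y v
        \<le> K * mass_norm m (x - y) * mass_norm m v / \<mu> ^ 3" by simp
  next
    fix x y \<mu> assume *: "(0::real) < \<mu>" "x \<in> sector \<kappa>" "y \<in> sector \<kappa>" "\<mu> \<le> axial x" "\<mu> \<le> axial y"
    have "newton_potential m y - newton_potential m x - potential_deriv m x (y - x)
        \<le> pair_mass * (6 * (norm (x - y))\<^sup>2 / (c * \<mu>) ^ 3)"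
      using * c sep' by (intro newton_potential_taylor) auto
    also have "\<dots> \<le> ?P * (6 * (b * mass_norm m (x - y))\<^sup>2 / (c * \<mu>) ^ 3)"
      using b c * pair_mass_nonneg by (intro mult_mono divide_right_mono power_mono) auto
    also have "\<dots> = (?P * (6 * b\<^sup>2 / c ^ 3)) * ((mass_norm m (x - y))\<^sup>2 / \<mu> ^ 3)"
      by (simp add: power_mult_distrib)
    also have "\<dots> \<le> K * ((mass_norm m (x - y))\<^sup>2 / \<mu> ^ 3)"
      using K(3) by (rule mult_right_mono) (use * in simp)
    finally show "newton_potential m y - newton_potential m x - potential_deriv m x (y - x)
        \<le> K * (mass_norm m (x - y))\<^sup>2 / \<mu> ^ 3" by simp
  qed
qed

end

section \<open>Actions of smooth curves\<close>

lemma abs_continuous_on_lipschitz: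
  fixes f :: "real \<Rightarrow> 'b::metric_space"
  assumes "\<And>p q. s0 \<le> p \<Longrightarrow> p \<le> q \<Longrightarrow> q \<le> s1 \<Longrightarrow> dist (f p) (f q) \<le> B * (q - p)"
  shows "abs_continuous_on s0 s1 f"
  unfolding abs_continuous_on_def
proof (intro allI impI)
  fix \<epsilon> :: real assume "0 < \<epsilon>"
  let ?B = "\<bar>B\<bar> + 1"
  have "(\<Sum>(p,q)\<in>P. dist (f p) (f q)) < \<epsilon>"
    if P: "\<forall>(p,q)\<in>P. s0 \<le> p \<and> p \<le> q \<and> q \<le> s1" and lt: "(\<Sum>(p,q)\<in>P. q - p) < \<epsilon> / ?B" for P
  proof -
    have "(\<Sum>(p,q)\<in>P. dist (f p) (f q)) \<le> (\<Sum>(p,q)\<in>P. ?B * (q - p))"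
    proof (intro sum_mono, clarify)
      fix p q assume "(p, q) \<in> P"
      then have pq: "s0 \<le> p" "p \<le> q" "q \<le> s1" using P by auto
      have "B * (q - p) \<le> ?B * (q - p)" using pq by (intro mult_right_mono) auto
      then show "dist (f p) (f q) \<le> ?B * (q - p)" using assms[OF pq] by linarith
    qed
    also have "\<dots> = ?B * (\<Sum>(p,q)\<in>P. q - p)"
      by (simp add: sum_distrib_left case_prod_unfold)
    also have "\<dots> < \<epsilon>" using lt by (simp add: field_simps)
    finally show ?thesis .
  qed
  then show "\<exists>\<delta>>0. \<forall>P. finite P \<and> (\<forall>(p,q)\<in>P. s0 \<le> p \<and> p \<le> q \<and> q \<le> s1) \<and>
       disjoint_family_on (\<lambda>(p,q). {p<..<q}) P \<and> (\<Sum>(p,q)\<in>P. q - p) < \<delta>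
       \<longrightarrow> (\<Sum>(p,q)\<in>P. dist (f p) (f q)) < \<epsilon>"
    using \<open>0 < \<epsilon>\<close> by (intro exI[of _ "\<epsilon> / ?B"]) auto
qed

lemma abs_continuous_on_C1:
  fixes f :: "real \<Rightarrow> 'b::real_normed_vector"
  assumes deriv: "\<And>t. t \<in> {s0..s1} \<Longrightarrow> (f has_vector_derivative f' t) (at t within {s0..s1})"
    and cont: "continuous_on {s0..s1} f'"
  shows "abs_continuous_on s0 s1 f"
proof -
  have "bounded (f' ` {s0..s1})"
    using compact_imp_bounded[OF compact_continuous_image[OF cont]] by simp
  then obtain B where B: "\<And>t. t \<in> {s0..s1} \<Longrightarrow> norm (f' t) \<le> B"
    unfolding bounded_iff by blast
  have "dist (f p) (f q) \<le> B * (q - p)" if "s0 \<le> p" "p \<le> q" "q \<le> s1" for p q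
  proof -
    have "norm (f q - f p) \<le> B * norm (q - p)"
    proof (rule differentiable_bound[where S = "{s0..s1}" and f' = "\<lambda>t h. h *\<^sub>R f' t"])
      show "onorm (\<lambda>h. h *\<^sub>R f' t) \<le> B" if "t \<in> {s0..s1}" for t
        using B[OF that] by (intro onorm_le) (simp add: mult.commute[of B] mult_left_mono)
    qed (use that deriv in \<open>auto simp: has_vector_derivative_def\<close>)
    then show ?thesis using that by (simp add: dist_norm norm_minus_commute)
  qed
  then show ?thesis by (rule abs_continuous_on_lipschitz)
qed

lemma abs_continuous_on_imp_continuous_on:
  assumes "abs_continuous_on s0 s1 f"
  shows "continuous_on {s0..s1} f"
  unfolding continuous_on_iff
proof (intro ballI allI impI)
  fix t \<epsilon> :: real assume t: "t \<in> {s0..s1}" and "0 < \<epsilon>"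
  then obtain \<delta> where \<delta>: "\<delta> > 0" and
    *: "\<forall>P. finite P \<and> (\<forall>(p,q)\<in>P. s0 \<le> p \<and> p \<le> q \<and> q \<le> s1) \<and>
       disjoint_family_on (\<lambda>(p,q). {p<..<q}) P \<and> (\<Sum>(p,q)\<in>P. q - p) < \<delta>
       \<longrightarrow> (\<Sum>(p,q)\<in>P. dist (f p) (f q)) < \<epsilon>"
    using assms unfolding abs_continuous_on_def by blast
  have "dist (f p) (f q) < \<epsilon>" if "s0 \<le> p" "p \<le> q" "q \<le> s1" "q - p < \<delta>" for p q
    using *[rule_format, of "{(p, q)}"] that by (simp add: disjoint_family_on_def)
  note * = this
  have "dist (f t') (f t) < \<epsilon>" if "t' \<in> {s0..s1}" "dist t' t < \<delta>" for t'
  proof (cases "t' \<le> t")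
    case True
    then show ?thesis using * that t by (auto simp: dist_real_def)
  next
    case False
    then have "dist (f t) (f t') < \<epsilon>" using * that t by (auto simp: dist_real_def)
    then show ?thesis by (simp add: dist_commute)
  qed
  with \<delta> show "\<exists>d>0. \<forall>x'\<in>{s0..s1}. dist x' t < d \<longrightarrow> dist (f x') (f t) < \<epsilon>" by blast
qed

section \<open>The action as an integral of real functions\<close>

context newton_masses
begin

definition lagrangian :: "real \<Rightarrow> ('e::euclidean_space, 'n) vec \<Rightarrow> ('e, 'n) vec \<Rightarrow> real" where
  "lagrangian h x v = (mass_norm m v)\<^sup>2 / 2 + newton_potential m x + h"

lemma lagrangian_nonneg: "0 \<le> h \<Longrightarrow> 0 \<le> lagrangian h x v"
  by (simp add: lagrangian_def newton_potential_nonneg)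

lemma action_integrand:
  assumes "s0 < s1" "0 \<le> h" "t \<in> {s0..s1}"
    and "(\<gamma> has_vector_derivative v) (at t within {s0..s1})" "\<gamma> t \<in> collision_free"
  shows "ennreal ((mass_norm m (vector_derivative \<gamma> (at t within {s0..s1})))\<^sup>2 / 2)
      + newton_potential_ext m (\<gamma> t) + ennreal h = ennreal (lagrangian h (\<gamma> t) v)"
  using assms vector_derivative_within_closed_interval[OF assms(1,3,4)]
  by (simp add: newton_potential_ext_def lagrangian_def newton_potential_nonneg)

text \<open>The comparison takes place inside \<open>nn_integral\<close>, which is monotone without
  measurability. Hence only the majorant \<open>f\<close> has to be integrable, not the Lagrangian
  of the curve.\<close>

lemma action_le:
  assumes "s0 < s1" "0 \<le> h"
    and "\<And>t. t \<in> {s0..s1} \<Longrightarrow> (\<gamma> has_vector_derivative v t) (at t within {s0..s1})"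
    and "\<And>t. t \<in> {s0..s1} \<Longrightarrow> \<gamma> t \<in> collision_free"
    and le: "\<And>t. t \<in> {s0..s1} \<Longrightarrow> lagrangian h (\<gamma> t) (v t) \<le> f t"
    and f: "(f has_integral I) {s0..s1}"
  shows "action m h s0 s1 \<gamma> \<le> ennreal I"
proof -
  have "action m h s0 s1 \<gamma> = (\<integral>\<^sup>+t\<in>{s0..s1}. ennreal (lagrangian h (\<gamma> t) (v t)) \<partial>lborel)"
    unfolding action_def using action_integrand[OF assms(1,2) _ assms(3,4)]
    by (intro nn_integral_cong) (auto simp: indicator_def)
  also have "\<dots> \<le> (\<integral>\<^sup>+t\<in>{s0..s1}. ennreal (f t) \<partial>lborel)"
    using le by (intro nn_integral_mono) (auto simp: indicator_def intro: ennreal_leI)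
  also have "\<dots> = ennreal I"
    using le lagrangian_nonneg[OF assms(2)] f
    by (intro nn_integral_has_integral_lebesgue') (auto intro: order_trans)
  finally show ?thesis .
qed

lemma action_eq:
  assumes "s0 < s1" "0 \<le> h"
    and "\<And>t. t \<in> {s0..s1} \<Longrightarrow> (\<gamma> has_vector_derivative v t) (at t within {s0..s1})"
    and "\<And>t. t \<in> {s0..s1} \<Longrightarrow> \<gamma> t \<in> collision_free"
    and f: "((\<lambda>t. lagrangian h (\<gamma> t) (v t)) has_integral I) {s0..s1}"
  shows "action m h s0 s1 \<gamma> = ennreal I"
proof -
  have "action m h s0 s1 \<gamma> = (\<integral>\<^sup>+t\<in>{s0..s1}. ennreal (lagrangian h (\<gamma> t) (v t)) \<partial>lborel)"
    unfolding action_def using action_integrand[OF assms(1,2) _ assms(3,4)]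
    by (intro nn_integral_cong) (auto simp: indicator_def)
  also have "\<dots> = ennreal I"
    using lagrangian_nonneg[OF assms(2)] f by (intro nn_integral_has_integral_lebesgue') auto
  finally show ?thesis .
qed

text \<open>From here on curves are run backwards in time, as in the third clause of the definition of
  hyperbolic viscosity solutions.\<close>

lemma dominated_reverse:
  assumes dom: "dominated m h u" and "t0 < t1" "0 \<le> h"
    and deriv: "\<And>t. t \<in> {t0..t1} \<Longrightarrow> (\<eta> has_vector_derivative v t) (at t within {t0..t1})"
    and cont: "continuous_on {t0..t1} v"
    and free: "\<And>t. t \<in> {t0..t1} \<Longrightarrow> \<eta> t \<in> collision_free"
    and le: "\<And>t. t \<in> {t0..t1} \<Longrightarrow> lagrangian h (\<eta> t) (v t) \<le> f t"
    and f: "(f has_integral I) {t0..t1}"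
  shows "u (\<eta> t0) - u (\<eta> t1) \<le> I"
proof -
  let ?\<gamma> = "\<lambda>s. \<eta> (- s)"
  have img: "uminus ` {-t1..-t0} = {t0..t1}" by force
  have d: "(?\<gamma> has_vector_derivative - v (- s)) (at s within {-t1..-t0})" if "s \<in> {-t1..-t0}" for s
  proof -
    have "((\<eta> \<circ> uminus) has_vector_derivative (- 1) *\<^sub>R v (- s)) (at s within {-t1..-t0})"
      by (rule vector_diff_chain_within) (use that deriv[of "- s"] img in \<open>auto intro!: derivative_eq_intros\<close>)
    then show ?thesis by (simp add: o_def)
  qed
  have ac: "abs_continuous_on (- t1) (- t0) ?\<gamma>"
    by (rule abs_continuous_on_C1[OF d])
      (auto intro!: continuous_intros continuous_on_compose2[OF cont])
  have "action m h (- t1) (- t0) ?\<gamma> \<le> ennreal I"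
  proof (rule action_le[OF _ \<open>0 \<le> h\<close> d])
    show "((\<lambda>s. f (- s)) has_integral I) {-t1..-t0}" using f by simp
    \<comment> \<open>Reversal changes only the sign of the velocity, and the Lagrangian is even in
      it.\<close>
    show "lagrangian h (\<eta> (- t)) (- v (- t)) \<le> f (- t)" if "t \<in> {-t1..-t0}" for t
      using le[of "- t"] that by (simp add: lagrangian_def)
  qed (use free \<open>t0 < t1\<close> in auto)
  then have "enn2ereal (action m h (- t1) (- t0) ?\<gamma>) \<le> enn2ereal (ennreal I)"
    by (simp add: less_eq_ennreal.rep_eq)
  moreover have "0 \<le> I"
    using f le lagrangian_nonneg[OF \<open>0 \<le> h\<close>] by (intro has_integral_nonneg[OF f]) (auto intro: order_trans)
  moreover have "ereal (u (?\<gamma> (- t0)) - u (?\<gamma> (- t1))) \<le> enn2ereal (action m h (- t1) (- t0) ?\<gamma>)"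
  proof -
    have "- t1 \<le> - t0" using \<open>t0 < t1\<close> by simp
    then show ?thesis using dom ac unfolding dominated_def by blast
  qed
  ultimately have "ereal (u (\<eta> t0) - u (\<eta> t1)) \<le> ereal I"
    by (metis enn2ereal_ennreal order_trans minus_minus)
  then show ?thesis by simp
qed

lemma calibrates_reverse:
  assumes cal: "calibrates m h u {..0} \<gamma>" and "0 \<le> t0" "t0 < t1" "0 \<le> h"
    and deriv: "\<And>t. t \<in> {t0..t1} \<Longrightarrow> ((\<lambda>t. \<gamma> (- t)) has_vector_derivative v t) (at t within {t0..t1})"
    and cont: "continuous_on {t0..t1} v"
    and free: "\<And>t. t \<in> {t0..t1} \<Longrightarrow> \<gamma> (- t) \<in> collision_free"
    and f: "(\<lambda>t. lagrangian h (\<gamma> (- t)) (v t)) integrable_on {t0..t1}"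
  shows "((\<lambda>t. lagrangian h (\<gamma> (- t)) (v t)) has_integral (u (\<gamma> (- t0)) - u (\<gamma> (- t1)))) {t0..t1}"
proof -
  let ?I = "integral {t0..t1} (\<lambda>t. lagrangian h (\<gamma> (- t)) (v t))"
  have I: "((\<lambda>t. lagrangian h (\<gamma> (- t)) (v t)) has_integral ?I) {t0..t1}"
    using f by (rule integrable_integral)
  have img: "uminus ` {-t1..-t0} = {t0..t1}" by force
  have d: "(\<gamma> has_vector_derivative - v (- s)) (at s within {-t1..-t0})" if "s \<in> {-t1..-t0}" for s
  proof -
    have "(((\<lambda>t. \<gamma> (- t)) \<circ> uminus) has_vector_derivative (- 1) *\<^sub>R v (- s)) (at s within {-t1..-t0})"
      by (rule vector_diff_chain_within) (use that deriv[of "- s"] img in \<open>auto intro!: derivative_eq_intros\<close>)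
    then show ?thesis by (simp add: o_def)
  qed
  have "action m h (- t1) (- t0) \<gamma> = ennreal ?I"
  proof (rule action_eq[OF _ \<open>0 \<le> h\<close> d])
    have "((\<lambda>s. lagrangian h (\<gamma> (- (- s))) (v (- s))) has_integral ?I) {-t1..-t0}"
      using I has_integral_reflect_real[of "\<lambda>t. lagrangian h (\<gamma> (- t)) (v t)" ?I t1 t0] by simp
    then show "((\<lambda>s. lagrangian h (\<gamma> s) (- v (- s))) has_integral ?I) {-t1..-t0}"
      by (simp add: lagrangian_def)
    show "\<gamma> t \<in> collision_free" if "t \<in> {-t1..-t0}" for t
      using free[of "- t"] that by auto
  qed (use \<open>t0 < t1\<close> in auto)
  moreover have "0 \<le> ?I"
    using lagrangian_nonneg[OF \<open>0 \<le> h\<close>] by (intro has_integral_nonneg[OF I]) auto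
  moreover have "ereal (u (\<gamma> (- t0)) - u (\<gamma> (- t1))) = enn2ereal (action m h (- t1) (- t0) \<gamma>)"
  proof -
    have "- t1 \<le> - t0" "{-t1..-t0} \<subseteq> {..0}" using assms(2,3) by auto
    then show ?thesis using cal unfolding calibrates_def by blast
  qed
  ultimately show ?thesis using I by (simp add: enn2ereal_ennreal)
qed

end

section \<open>Reversed calibrating curves as motions\<close>

context newton_shape
begin

text \<open>The usable content of clauses (ii) and (iii) for a reversed curve. Derivatives and
  energy integrals are confined to positive times, because the motion is given on
  \<open>{0<..}\<close> only; at time 0 there is just continuity, which comes from absolute
  continuity. Newton's equation is stated weakly, by testing against \<open>d\<close>.\<close>

definition calibrated_motion ::
    "(('e, 'n) vec \<Rightarrow> real) \<Rightarrow> (real \<Rightarrow> ('e, 'n) vec) \<Rightarrow> (real \<Rightarrow> ('e, 'n) vec) \<Rightarrow> (real \<Rightarrow> ('e, 'n) vec) \<Rightarrow> bool" where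
  "calibrated_motion u x v w \<longleftrightarrow>
    (\<forall>T. continuous_on {0..T} x) \<and>
    (\<forall>t>0. x t \<in> collision_free \<and> (x has_vector_derivative v t) (at t) \<and>
      (v has_vector_derivative w t) (at t) \<and> (\<forall>d. mass_inner m (w t) d = potential_deriv m (x t) d)) \<and>
    (\<forall>\<epsilon>>0. eventually (\<lambda>t. mass_norm m (x t - t *\<^sub>R a) \<le> \<epsilon> * t) at_top) \<and>
    (\<forall>t0 t1. 0 < t0 \<and> t0 < t1 \<longrightarrow>
      ((\<lambda>t. lagrangian (speed\<^sup>2 / 2) (x t) (v t)) has_integral (u (x t0) - u (x t1))) {t0..t1})"

lemma calibrated_motion_exists:
  assumes cal: "calibrates m (speed\<^sup>2 / 2) u {..0} \<gamma>"
    and hyp: "is_hyperbolic_motion m a {0<..} (\<lambda>t. \<gamma> (- t))"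
  shows "\<exists>v w. calibrated_motion u (\<lambda>t. \<gamma> (- t)) v w"
proof -
  let ?x = "\<lambda>t. \<gamma> (- t)"
  obtain v w where "\<forall>t\<in>{0<..}. ?x t \<in> collision_free \<and>
       (?x has_vector_derivative v t) (at t within {0<..}) \<and>
       (v has_vector_derivative w t) (at t within {0<..}) \<and>
       has_mass_gradient m (newton_potential m) (w t) (?x t)"
    using hyp unfolding is_hyperbolic_motion_def is_motion_def by (elim conjE exE) (rule that)
  moreover have "at t within {0<..} = at t" if "0 < t" for t :: real
    using that by (intro at_within_open) auto
  ultimately have free: "?x t \<in> collision_free" and dx: "(?x has_vector_derivative v t) (at t)"
    and dv: "(v has_vector_derivative w t) (at t)"
    and grad: "has_mass_gradient m (newton_potential m) (w t) (?x t)" if "0 < t" for t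
    using that by (metis greaterThan_iff)+
  have w: "mass_inner m (w t) d = potential_deriv m (?x t) d" if "0 < t" for t d
    using has_derivative_unique[OF grad[OF that, unfolded has_mass_gradient_def]
        newton_potential_has_derivative[OF free[OF that]]] by (simp add: fun_eq_iff)
  have cont: "continuous_on {0..T} ?x" for T
  proof (cases "0 \<le> T")
    case True
    then have "continuous_on {-T..0} \<gamma>"
      using cal abs_continuous_on_imp_continuous_on[of "-T" 0 \<gamma>] by (auto simp: calibrates_def)
    then show ?thesis by (rule continuous_on_compose2) (auto intro!: continuous_intros)
  qed simp
  have asym: "eventually (\<lambda>t. mass_norm m (?x t - t *\<^sub>R a) \<le> \<epsilon> * t) at_top" if "0 < \<epsilon>" for \<epsilon>
  proof -
    have "eventually (\<lambda>t. norm (mass_norm m (?x t - t *\<^sub>R a)) \<le> \<epsilon> * norm t) at_top"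
      using hyp that unfolding is_hyperbolic_motion_def by (intro landau_o.smallD) auto
    then show ?thesis using eventually_ge_at_top[of 0] by eventually_elim simp
  qed
  have "((\<lambda>t. lagrangian (speed\<^sup>2 / 2) (?x t) (v t)) has_integral (u (?x t0) - u (?x t1))) {t0..t1}"
    if t: "0 < t0" "t0 < t1" for t0 t1
  proof (rule calibrates_reverse[OF cal])
    have "isCont v t" if "0 < t" for t
      using has_vector_derivative_continuous[OF dv[OF that]] .
    then show cv: "continuous_on {t0..t1} v"
      using t(1) by (intro continuous_at_imp_continuous_on) auto
    have "isCont (\<lambda>t. newton_potential m (?x t)) t" if "0 < t" for t
      using has_vector_derivative_continuous[OF dx[OF that]]
        has_derivative_continuous[OF newton_potential_has_derivative[OF free[OF that]]]
      by (rule isCont_o2)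
    then have "continuous_on {t0..t1} (\<lambda>t. newton_potential m (?x t))"
      using t(1) by (intro continuous_at_imp_continuous_on) auto
    then show "(\<lambda>t. lagrangian (speed\<^sup>2 / 2) (?x t) (v t)) integrable_on {t0..t1}"
      unfolding lagrangian_def
      by (intro integrable_continuous_interval continuous_intros
          continuous_on_compose2[OF continuous_on_mass_norm[of UNIV] cv]) auto
  qed (use t dx free in \<open>auto intro: has_vector_derivative_at_within\<close>)
  note energy = this
  show ?thesis
    unfolding calibrated_motion_def
    by (rule exI[of _ v], rule exI[of _ w], intro conjI allI impI)
      (auto simp: cont intro: free dx dv w asym energy)
qed

text \<open>Domination along \<eta> and calibration along \<open>x\<close> are subtracted, so that
  only the excess \<open>f\<close> of one Lagrangian over the other has to be integrated. The
  endpoints of \<eta> are free.\<close>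

lemma calibrated_motion_competitor:
  assumes dom: "dominated m (speed\<^sup>2 / 2) u" and x: "calibrated_motion u x v w"
    and t: "0 < t0" "t0 < t1"
    and deriv: "\<And>t. t \<in> {t0..t1} \<Longrightarrow> (\<eta> has_vector_derivative \<eta>' t) (at t within {t0..t1})"
    and cont: "continuous_on {t0..t1} \<eta>'"
    and free: "\<And>t. t \<in> {t0..t1} \<Longrightarrow> \<eta> t \<in> collision_free"
    and le: "\<And>t. t \<in> {t0..t1} \<Longrightarrow> lagrangian (speed\<^sup>2 / 2) (\<eta> t) (\<eta>' t)
        \<le> lagrangian (speed\<^sup>2 / 2) (x t) (v t) + f t"
    and f: "(f has_integral I) {t0..t1}"
  shows "u (\<eta> t0) - u (\<eta> t1) \<le> u (x t0) - u (x t1) + I"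
proof (rule dominated_reverse[OF dom t(2) _ deriv cont free le has_integral_add[OF _ f]])
  show "((\<lambda>t. lagrangian (speed\<^sup>2 / 2) (x t) (v t)) has_integral (u (x t0) - u (x t1))) {t0..t1}"
    using x t unfolding calibrated_motion_def by blast
qed simp_all

text \<open>From \<open>mass_norm m (v + e) \<ge> 0\<close>, squared, and nonnegativity of the
  potential, the Lagrangian at energy \<open>speed\<^sup>2 / 2\<close> is at least
  \<open>- mass_inner m e v\<close>, an exact derivative along the motion.\<close>

lemma calibrated_motion_lower_bound:
  assumes x: "calibrated_motion u x v w" and t: "0 < t0" "t0 < t1"
    and e: "mass_norm m e = speed"
  shows "mass_inner m e (x t0 - x t1) \<le> u (x t0) - u (x t1)"
proof (rule has_integral_le)
  have "((\<lambda>t. - mass_inner m e (v t)) has_integral (- mass_inner m e (x t1) - - mass_inner m e (x t0))) {t0..t1}"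
    using t x
    by (intro fundamental_theorem_of_calculus has_vector_derivative_minus
        bounded_linear.has_vector_derivative[OF bounded_bilinear.bounded_linear_right[OF bounded_bilinear_mass_inner]])
      (auto simp: calibrated_motion_def intro: has_vector_derivative_at_within)
  then show "((\<lambda>t. - mass_inner m e (v t)) has_integral mass_inner m e (x t0 - x t1)) {t0..t1}"
    by (simp add: mass_inner_linear)
  show "((\<lambda>t. lagrangian (speed\<^sup>2 / 2) (x t) (v t)) has_integral (u (x t0) - u (x t1))) {t0..t1}"
    using x t by (simp add: calibrated_motion_def)
  show "- mass_inner m e (v t) \<le> lagrangian (speed\<^sup>2 / 2) (x t) (v t)" for t
  proof -
    have "0 \<le> (mass_norm m (v t + e))\<^sup>2" by simp
    also have "\<dots> = (mass_norm m (v t))\<^sup>2 + 2 * mass_inner m e (v t) + speed\<^sup>2"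
      by (simp add: mass_norm_square mass_inner_linear mass_inner_commute e[symmetric])
    finally show ?thesis
      using newton_potential_nonneg[of "x t"] by (simp add: lagrangian_def)
  qed
qed

end

section \<open>Motions in a sector\<close>

context newton_sector
begin

lemma calibrated_motionD:
  assumes "calibrated_motion u x v w"
  shows "\<And>T. continuous_on {0..T} x"
    and "\<And>t. 0 < t \<Longrightarrow> (x has_vector_derivative v t) (at t)"
    and "\<And>t. 0 < t \<Longrightarrow> (v has_vector_derivative w t) (at t)"
    and "\<And>t d. 0 < t \<Longrightarrow> mass_inner m (w t) d = potential_deriv m (x t) d"
    and "\<And>\<epsilon>. 0 < \<epsilon> \<Longrightarrow> eventually (\<lambda>t. mass_norm m (x t - t *\<^sub>R a) \<le> \<epsilon> * t) at_top"
    and "\<And>t. 0 < t \<Longrightarrow> isCont x t"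
    and "\<And>t. 0 < t \<Longrightarrow> isCont v t"
  using assms has_vector_derivative_continuous unfolding calibrated_motion_def by blast+

text \<open>A bound on a linear form, tested at the vector that represents it, bounds the norm of
  that vector.\<close>

lemma mass_norm_le_if_self_bound:
  assumes "mass_inner m d d \<le> B * mass_norm m d" "0 \<le> B"
  shows "mass_norm m d \<le> B"
  using assms mass_norm_nonneg[of d]
  by (cases "mass_norm m d = 0") (auto simp: mass_norm_square[symmetric] power2_eq_square)

lemma acceleration_bound:
  assumes x: "calibrated_motion u x v w" and "0 < t" "x t \<in> sector \<kappa>" "0 < \<mu>" "\<mu> \<le> axial (x t)"
  shows "mass_norm m (w t) \<le> K / \<mu>\<^sup>2"
proof (rule mass_norm_le_if_self_bound)
  show "mass_inner m (w t) (w t) \<le> K / \<mu>\<^sup>2 * mass_norm m (w t)"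
    using force_bound[of \<mu> "x t" "w t"] assms by (simp add: calibrated_motionD(4)[OF x])
qed (use K_pos in simp)

lemma acceleration_lip:
  assumes x: "calibrated_motion u x v w" "calibrated_motion u y v' w'" and "0 < t"
    and "x t \<in> sector \<kappa>" "y t \<in> sector \<kappa>" "0 < \<mu>" "\<mu> \<le> axial (x t)" "\<mu> \<le> axial (y t)"
  shows "mass_norm m (w t - w' t) \<le> K * mass_norm m (x t - y t) / \<mu> ^ 3"
proof (rule mass_norm_le_if_self_bound)
  show "mass_inner m (w t - w' t) (w t - w' t)
      \<le> K * mass_norm m (x t - y t) / \<mu> ^ 3 * mass_norm m (w t - w' t)"
    using force_lip[of \<mu> "x t" "y t" "w t - w' t"] assms
    by (simp add: calibrated_motionD(4)[OF x(1)] calibrated_motionD(4)[OF x(2)] mass_inner_linear(2))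
qed (use K_pos \<open>0 < \<mu>\<close> in simp)

text \<open>The antiderivative that converts inverse-square decay of the forces into inverse decay
  of the velocities.\<close>

lemma has_vector_derivative_reciprocal:
  assumes "c + r / 2 \<noteq> (0::real)"
  shows "((\<lambda>r. - (2 * B / (c + r / 2))) has_vector_derivative B / (c + r / 2)\<^sup>2) (at r)"
  unfolding has_real_derivative_iff_has_vector_derivative[symmetric]
  using assms by (auto intro!: derivative_eq_intros simp: power2_eq_square field_simps)

lemma continuous_on_reciprocal:
  assumes "\<And>r. r \<in> S \<Longrightarrow> c + r / 2 \<noteq> (0::real)"
  shows "continuous_on S (\<lambda>r. - (2 * B / (c + r / 2)))"
  using assms by (auto intro!: continuous_intros)

text \<open>Integrating the force bound from time \<open>t\<close> on, the velocity never differs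
  from \<open>v t\<close> by more than \<beta>. So the displacement over a long time is nearly
  \<open>v t\<close> times that time, while the asymptotics of \<open>x\<close> make it nearly
  \<open>a\<close> times that time; comparison at a large time bounds \<open>v t - a\<close> without
  first constructing a limit of \<open>v\<close>.\<close>

lemma velocity_limit:
  assumes x: "calibrated_motion u x v w" and s: "0 < s" "0 < c + s / 2"
    and adv: "\<And>t. s \<le> t \<Longrightarrow> x t \<in> sector \<kappa> \<and> c + t / 2 \<le> axial (x t)" and "s \<le> t"
  shows "mass_norm m (v t - a) \<le> 2 * K / (c + t / 2)"
proof -
  define \<beta> where "\<beta> = 2 * K / (c + t / 2)"
  have "mass_norm m (v r - v t) \<le> \<beta>" if "t \<le> r" for r
  proof -
    have "mass_norm m (v r - v t) \<le> - (2 * K / (c + r / 2)) - - (2 * K / (c + t / 2))"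
    proof (rule mass_norm_mean_value[OF that])
      show "continuous_on {t..r} v"
        using calibrated_motionD(7)[OF x] s \<open>s \<le> t\<close> by (intro continuous_at_imp_continuous_on) auto
      show "continuous_on {t..r} (\<lambda>r. - (2 * K / (c + r / 2)))"
        using s \<open>s \<le> t\<close> by (intro continuous_on_reciprocal) auto
      fix q assume q: "t < q" "q < r"
      show "(v has_vector_derivative w q) (at q)"
        using calibrated_motionD(3)[OF x] q s \<open>s \<le> t\<close> by simp
      show "((\<lambda>r. - (2 * K / (c + r / 2))) has_vector_derivative K / (c + q / 2)\<^sup>2) (at q)"
        using q s \<open>s \<le> t\<close> by (intro has_vector_derivative_reciprocal) auto
      show "mass_norm m (w q) \<le> K / (c + q / 2)\<^sup>2"
        using adv[of q] q s \<open>s \<le> t\<close> by (intro acceleration_bound[OF x]) auto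
    qed
    also have "\<dots> \<le> \<beta>" using that s \<open>s \<le> t\<close> K_pos by (simp add: \<beta>_def)
    finally show ?thesis .
  qed
  note vel = this
  have pos: "mass_norm m (x r - x t - (r - t) *\<^sub>R v t) \<le> \<beta> * (r - t)" if "t \<le> r" for r
  proof -
    have "mass_norm m ((x r - (r - t) *\<^sub>R v t) - (x t - (t - t) *\<^sub>R v t)) \<le> \<beta> * r - \<beta> * t"
    proof (rule mass_norm_mean_value[OF that])
      show "continuous_on {t..r} (\<lambda>q. x q - (q - t) *\<^sub>R v t)"
        using calibrated_motionD(6)[OF x] s \<open>s \<le> t\<close>
        by (intro continuous_intros continuous_at_imp_continuous_on) auto
      fix q assume q: "t < q" "q < r"
      show "((\<lambda>q. x q - (q - t) *\<^sub>R v t) has_vector_derivative v q - v t) (at q)"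
        using calibrated_motionD(2)[OF x, of q] q s \<open>s \<le> t\<close>
        by (auto intro!: derivative_eq_intros)
      show "mass_norm m (v q - v t) \<le> \<beta>" using vel q by simp
    qed (auto intro!: continuous_intros derivative_eq_intros)
    then show ?thesis by (simp add: algebra_simps)
  qed
  have "mass_norm m (v t - a) \<le> \<beta> + \<epsilon>" if "0 < \<epsilon>" for \<epsilon>
  proof (rule ccontr)
    assume "\<not> ?thesis"
    then have big: "\<beta> + \<epsilon> < mass_norm m (v t - a)" by simp
    define M where "M = mass_norm m (x t) + t * speed"
    obtain r0 where r0: "\<And>r. r0 \<le> r \<Longrightarrow> mass_norm m (x r - r *\<^sub>R a) \<le> \<epsilon> / 2 * r"
      using calibrated_motionD(5)[OF x, of "\<epsilon> / 2"] \<open>0 < \<epsilon>\<close> by (auto simp: eventually_at_top_linorder)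
    \<comment> \<open>Large enough that the asymptotic estimate holds at \<open>r\<close>, that
      \<open>r - t\<close> is positive, and that half of the gain \<epsilon> per unit time outweighs
      the fixed cost \<open>M + \<epsilon> * t\<close>.\<close>
    define r where "r = max (max r0 (t + 1)) (2 * (M + \<epsilon> * t) / \<epsilon>)"
    have r: "r0 \<le> r" "t < r" "2 * (M + \<epsilon> * t) / \<epsilon> \<le> r" by (auto simp: r_def)
    have "(r - t) * mass_norm m (v t - a) = mass_norm m ((r - t) *\<^sub>R (v t - a))"
      using r by (simp add: mass_norm_scaleR)
    also have "(r - t) *\<^sub>R (v t - a)
        = (x r - r *\<^sub>R a) - (x t - t *\<^sub>R a) - (x r - x t - (r - t) *\<^sub>R v t)"
      by (simp add: algebra_simps)
    also have "mass_norm m \<dots> \<le> mass_norm m (x r - r *\<^sub>R a) + mass_norm m (x t - t *\<^sub>R a)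
        + mass_norm m (x r - x t - (r - t) *\<^sub>R v t)"
      by (intro order_trans[OF mass_norm_triangle_diff] add_right_mono mass_norm_triangle_diff)
    also have "\<dots> \<le> \<epsilon> / 2 * r + M + \<beta> * (r - t)"
    proof (intro add_mono)
      have "mass_norm m (x t - t *\<^sub>R a) \<le> mass_norm m (x t) + mass_norm m (t *\<^sub>R a)"
        by (rule mass_norm_triangle_diff)
      then show "mass_norm m (x t - t *\<^sub>R a) \<le> M"
        using s \<open>s \<le> t\<close> by (simp add: M_def mass_norm_scaleR speed_def)
    qed (use r0 pos r in auto)
    finally have "(r - t) * mass_norm m (v t - a) \<le> \<epsilon> / 2 * r + M + \<beta> * (r - t)" .
    moreover have "(r - t) * (\<beta> + \<epsilon>) < (r - t) * mass_norm m (v t - a)"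
      using big r by (intro mult_strict_left_mono) auto
    moreover have "2 * (M + \<epsilon> * t) \<le> r * \<epsilon>"
      using r(3) \<open>0 < \<epsilon>\<close> by (simp add: divide_le_eq)
    ultimately show False by (simp add: algebra_simps)
  qed
  then show ?thesis unfolding \<beta>_def[symmetric] by (rule field_le_epsilon)
qed

text \<open>This is \<open>calibrated_motion_lower_bound\<close> for the vector \<open>e\<close> of
  norm \<open>speed\<close> pointing from \<open>x s\<close> to \<open>x 0\<close>. Since that bound
  requires a positive initial time, it is carried to time 0 by continuity of \<open>u\<close> and
  \<open>x\<close>.\<close>

lemma chord_bound:
  assumes x: "calibrated_motion u x v w" and u: "continuous_on UNIV u" and "0 < s"
  shows "speed * mass_norm m (x 0 - x s) \<le> u (x 0) - u (x s)"
proof (cases "x 0 = x s")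
  case False
  let ?d = "x 0 - x s"
  have d: "0 < mass_norm m ?d"
    using False by (simp add: mass_norm_eq_zero_iff less_le)
  define e where "e = (speed / mass_norm m ?d) *\<^sub>R ?d"
  have e: "mass_norm m e = speed"
    using d speed_pos by (simp add: e_def mass_norm_scaleR)
  have cont: "continuous_on {0..s} x" by (rule calibrated_motionD(1)[OF x])
  have "continuous_on {0..s} (\<lambda>t. u (x t) - u (x s) - mass_inner m e (x t - x s))"
    by (intro continuous_intros continuous_on_compose2[OF u cont]
        bounded_bilinear.continuous_on[OF bounded_bilinear_mass_inner] cont) auto
  note bspec[OF this[unfolded continuous_on_def], of 0]
  then have lim: "((\<lambda>t. u (x t) - u (x s) - mass_inner m e (x t - x s))
      \<longlongrightarrow> u (x 0) - u (x s) - mass_inner m e (x 0 - x s)) (at_right 0)"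
    using \<open>0 < s\<close> by (simp add: at_within_Icc_at_right)
  have "eventually (\<lambda>t. 0 \<le> u (x t) - u (x s) - mass_inner m e (x t - x s)) (at_right 0)"
    using eventually_at_right_less[of 0] eventually_at_right_real[OF \<open>0 < s\<close>]
    by eventually_elim (use calibrated_motion_lower_bound[OF x _ _ e] in auto)
  then have "0 \<le> u (x 0) - u (x s) - mass_inner m e ?d"
    by (rule tendsto_lowerbound[OF lim]) simp
  moreover have "mass_inner m e ?d = speed * mass_norm m ?d"
    using d by (simp add: e_def mass_inner_linear(3) mass_norm_square[symmetric] power2_eq_square)
  ultimately show ?thesis by simp
qed (use speed_pos in simp)

end

text \<open>The slopes \<kappa>/4 (cone), \<kappa>/3 (starting points), \<kappa>/2 (motions) and
  \<kappa> (estimates) are nested. \<open>\<rho>_action\<close> lets the error of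
  \<open>escape_shift_bound\<close> fit into the aperture of the cone, \<open>\<rho>_sector\<close>
  keeps the integrated velocity error below slope \<kappa>/2, and \<open>\<rho>_stable\<close> makes
  the self-referential coefficient in \<open>velocity_stability\<close> at most 1/2.\<close>

locale escape_region = newton_sector m a \<kappa> K
  for m :: "'n::{finite,linorder} \<Rightarrow> real" and a :: "('e::euclidean_space, 'n) vec" and \<kappa> K +
  fixes \<alpha> \<rho> :: real
  assumes \<alpha>_ge: "1 / 2 \<le> \<alpha>" and \<alpha>_less: "\<alpha> < 1"
    and \<alpha>_narrow: "speed\<^sup>2 * (1 / \<alpha>\<^sup>2 - 1) \<le> (\<kappa> / 4)\<^sup>2"
    and \<rho>_pos: "0 < \<rho>" and \<rho>_action: "4 * K + 1 \<le> (1 - \<alpha>) * speed * \<rho>"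
    and \<rho>_sector: "4 * K \<le> \<kappa> * \<rho>" and \<rho>_stable: "8 * K \<le> \<rho>"
begin

lemma \<rho>_speed: "4 * K \<le> speed * \<rho>"
proof -
  have "(1 - \<alpha>) * (speed * \<rho>) \<le> 1 * (speed * \<rho>)"
    using \<alpha>_ge speed_pos \<rho>_pos by (intro mult_right_mono) auto
  then show ?thesis using \<rho>_action by (simp add: mult.assoc)
qed

lemma mass_cone_narrow:
  assumes "x \<in> mass_cone m a \<alpha>"
  shows "radial x \<le> \<kappa> / 4 * axial x"
proof (rule power2_le_imp_le)
  have \<alpha>: "0 < \<alpha>" using \<alpha>_ge by simp
  have "(radial x)\<^sup>2 \<le> (axial x)\<^sup>2 * (speed\<^sup>2 * (1 / \<alpha>\<^sup>2 - 1))"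
    by (rule mass_cone_radial[OF assms \<alpha>])
  also have "\<dots> \<le> (axial x)\<^sup>2 * (\<kappa> / 4)\<^sup>2"
    using \<alpha>_narrow by (intro mult_left_mono) auto
  finally show "(radial x)\<^sup>2 \<le> (\<kappa> / 4 * axial x)\<^sup>2"
    by (simp only: power_mult_distrib mult.commute)
  show "0 \<le> \<kappa> / 4 * axial x" using mass_cone_radial(1)[OF assms \<alpha>] \<kappa>_pos by simp
qed

text \<open>Both inequalities are strict: this makes the region open, as needed for
  differentiability at its points, and yields the strict conclusions of
  \<open>no_turning_point\<close>.\<close>

definition start_region :: "('e, 'n) vec set" where
  "start_region = {x. radial x < \<kappa> / 3 * axial x \<and> \<rho> < axial x}"

text \<open>Uniform motion with velocity \<open>a\<close> has axial rate 1; asking only for rate 1/2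
  and slope \<kappa>/2 leaves room for perturbations.\<close>

definition escapes_from :: "real \<Rightarrow> (real \<Rightarrow> ('e, 'n) vec) \<Rightarrow> bool" where
  "escapes_from s x \<longleftrightarrow>
    (\<forall>t\<ge>s. radial (x t) \<le> \<kappa> / 2 * axial (x t) \<and> \<rho> + (t - s) / 2 \<le> axial (x t))"

lemma escapes_fromD:
  assumes "escapes_from s x" "s \<le> t"
  shows "x t \<in> sector \<kappa>" "x t \<in> sector (\<kappa> / 2)" "\<rho> \<le> axial (x t)" "\<rho> + (t - s) / 2 \<le> axial (x t)"
proof -
  show *: "\<rho> + (t - s) / 2 \<le> axial (x t)" using assms by (simp add: escapes_from_def)
  then show "\<rho> \<le> axial (x t)" using assms(2) by argo
  then show "x t \<in> sector (\<kappa> / 2)"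
    using assms \<rho>_pos by (simp add: escapes_from_def sector_def)
  then show "x t \<in> sector \<kappa>" by (rule sector_mono) (use \<kappa>_pos in simp)
qed

lemma escaping_velocity:
  assumes x: "calibrated_motion u x v w" and s: "0 < s" and esc: "escapes_from s x" and "s \<le> t"
  shows "mass_norm m (v t - a) \<le> 2 * K / (\<rho> + (t - s) / 2)" "mass_norm m (v t - a) \<le> 2 * K / \<rho>"
proof -
  \<comment> \<open>The constant \<open>c\<close> of \<open>velocity_limit\<close> is
    \<open>\<rho> - s / 2\<close>, which moves the origin of time to \<open>s\<close>.\<close>
  have "mass_norm m (v t - a) \<le> 2 * K / ((\<rho> - s / 2) + t / 2)"
    using escapes_fromD[OF esc] s \<rho>_pos \<open>s \<le> t\<close>
    by (intro velocity_limit[OF x s]) (auto simp: field_simps)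
  then show *: "mass_norm m (v t - a) \<le> 2 * K / (\<rho> + (t - s) / 2)"
    by (simp add: diff_divide_distrib add_diff_eq diff_add_eq)
  also have "\<dots> \<le> 2 * K / \<rho>"
    using K_pos \<rho>_pos \<open>s \<le> t\<close> by (intro frac_le) auto
  finally show "mass_norm m (v t - a) \<le> 2 * K / \<rho>" .
qed

text \<open>The velocity stays so close to \<open>a\<close> that the displacement itself, and not
  only the position, satisfies the slope bound \<kappa>. Adding it to a point of the sector
  therefore keeps that point in the sector.\<close>

lemma escaping_advance:
  assumes x: "calibrated_motion u x v w" and s: "0 < s" and esc: "escapes_from s x" and "s \<le> t"
  shows "(t - s) / 2 \<le> axial (x t - x s)" "radial (x t - x s) \<le> \<kappa> * axial (x t - x s)"
proof -
  define e where "e = x t - x s - (t - s) *\<^sub>R a"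
  have "mass_norm m ((x t - t *\<^sub>R a) - (x s - s *\<^sub>R a)) \<le> 2 * K / \<rho> * t - 2 * K / \<rho> * s"
  proof (rule mass_norm_mean_value[OF \<open>s \<le> t\<close>])
    show "continuous_on {s..t} (\<lambda>r. x r - r *\<^sub>R a)"
      using calibrated_motionD(6)[OF x] s by (intro continuous_intros continuous_at_imp_continuous_on) auto
    fix r assume r: "s < r" "r < t"
    show "((\<lambda>r. x r - r *\<^sub>R a) has_vector_derivative v r - a) (at r)"
      using calibrated_motionD(2)[OF x, of r] r s by (auto intro!: derivative_eq_intros)
    show "mass_norm m (v r - a) \<le> 2 * K / \<rho>" using escaping_velocity(2)[OF x s esc] r by simp
  qed (use \<rho>_pos in \<open>auto intro!: continuous_intros derivative_eq_intros\<close>)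
  moreover have "(x t - t *\<^sub>R a) - (x s - s *\<^sub>R a) = e"
    by (simp add: e_def algebra_simps)
  ultimately have e: "mass_norm m e \<le> 2 * K / \<rho> * (t - s)"
    by (simp add: right_diff_distrib)
  have xt: "x t - x s = e + (t - s) *\<^sub>R a" by (simp add: e_def)
  have "- axial e \<le> mass_norm m e / speed" using abs_axial_le[of e] by linarith
  also have "\<dots> \<le> (2 * K / \<rho>) * (t - s) / speed" using e speed_pos by (intro divide_right_mono) auto
  also have "\<dots> = (2 * K / (\<rho> * speed)) * (t - s)" by simp
  also have "\<dots> \<le> 1 / 2 * (t - s)"
    using \<rho>_speed \<rho>_pos speed_pos \<open>s \<le> t\<close> by (intro mult_right_mono) (auto simp: field_simps)
  finally show ax: "(t - s) / 2 \<le> axial (x t - x s)" by (simp add: xt axial_linear)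
  have "radial (x t - x s) \<le> 2 * K / \<rho> * (t - s)"
    unfolding xt by (rule order_trans[OF radial_le e])
  also have "\<dots> \<le> \<kappa> / 2 * (t - s)"
    using \<rho>_sector \<rho>_pos \<open>s \<le> t\<close> by (intro mult_right_mono) (auto simp: field_simps)
  also have "\<dots> = \<kappa> * ((t - s) / 2)" by simp
  also have "\<dots> \<le> \<kappa> * axial (x t - x s)" using ax \<kappa>_pos by (intro mult_left_mono) auto
  finally show "radial (x t - x s) \<le> \<kappa> * axial (x t - x s)" .
qed

lemma axial_radial_convex:
  assumes "x \<in> sector \<kappa>" "y \<in> sector \<kappa>" "\<rho> \<le> axial x" "\<rho> \<le> axial y" "0 \<le> \<theta>" "\<theta> \<le> 1"
  shows "\<rho> \<le> axial (\<theta> *\<^sub>R x + (1 - \<theta>) *\<^sub>R y)"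
    "radial (\<theta> *\<^sub>R x + (1 - \<theta>) *\<^sub>R y) \<le> \<kappa> * axial (\<theta> *\<^sub>R x + (1 - \<theta>) *\<^sub>R y)"
proof -
  have "\<theta> * \<rho> + (1 - \<theta>) * \<rho> \<le> \<theta> * axial x + (1 - \<theta>) * axial y"
    using assms by (intro add_mono mult_left_mono) auto
  then show "\<rho> \<le> axial (\<theta> *\<^sub>R x + (1 - \<theta>) *\<^sub>R y)" by (simp add: axial_linear algebra_simps)
  have "radial (\<theta> *\<^sub>R x + (1 - \<theta>) *\<^sub>R y) \<le> \<theta> * radial x + (1 - \<theta>) * radial y"
    using radial_add[of "\<theta> *\<^sub>R x" "(1 - \<theta>) *\<^sub>R y"] assms by (simp add: radial_scaleR)
  also have "\<dots> \<le> \<theta> * (\<kappa> * axial x) + (1 - \<theta>) * (\<kappa> * axial y)"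
    using assms by (intro add_mono mult_left_mono) (auto simp: sector_def)
  finally show "radial (\<theta> *\<^sub>R x + (1 - \<theta>) *\<^sub>R y) \<le> \<kappa> * axial (\<theta> *\<^sub>R x + (1 - \<theta>) *\<^sub>R y)"
    by (simp add: axial_linear algebra_simps)
qed

text \<open>The competitor starts at \<open>y\<close>, follows the translated motion and loses the
  translation linearly over time \<open>T\<close>. Three errors arise: replacing the velocity by
  \<open>a\<close> costs \<open>2 * K / \<rho>\<close> per unit of the norm of \<delta>, the
  potential costs the same after integration, and the quadratic kinetic term costs
  \<open>1 / (2 * \<rho>)\<close>.\<close>

lemma escape_shift_bound:
  assumes dom: "dominated m (speed\<^sup>2 / 2) u" and x: "calibrated_motion u x v w"
    and s: "0 < s" and esc: "escapes_from s x" and y: "y \<in> sector \<kappa>" "\<rho> \<le> axial y"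
  defines "\<delta> \<equiv> y - x s"
  shows "u y - u (x s) \<le> - mass_inner m a \<delta> + (4 * K + 1) / \<rho> * mass_norm m \<delta>"
proof (cases "y = x s")
  case False
  let ?N = "mass_norm m \<delta>"
  have N: "0 < ?N" using False by (simp add: \<delta>_def mass_norm_eq_zero_iff less_le)
  \<comment> \<open>With this duration the quadratic kinetic cost
    \<open>?N\<^sup>2 / (2 * T)\<close> becomes linear in \<open>?N\<close>, with a factor of order
    \<open>1 / \<rho>\<close>.\<close>
  define T where "T = \<rho> * ?N"
  have T: "0 < T" using N \<rho>_pos by (simp add: T_def)
  define \<eta> where "\<eta> = (\<lambda>t. x t + (1 - (t - s) / T) *\<^sub>R \<delta>)"
  define f where "f = (\<lambda>t. (- mass_inner m a \<delta> / T + 2 * K / \<rho> * ?N / T + ?N\<^sup>2 / (2 * T\<^sup>2))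
    + K * ?N / ((\<rho> - s / 2) + t / 2)\<^sup>2)"
  define I where "I = (- mass_inner m a \<delta> / T + 2 * K / \<rho> * ?N / T + ?N\<^sup>2 / (2 * T\<^sup>2)) * (s + T - s)
    + (- (2 * (K * ?N) / ((\<rho> - s / 2) + (s + T) / 2)) - - (2 * (K * ?N) / ((\<rho> - s / 2) + s / 2)))"
  have \<eta>: "\<eta> t \<in> sector \<kappa> \<and> \<rho> + (t - s) / 2 \<le> axial (\<eta> t)" if t: "t \<in> {s..s+T}" for t
  proof -
    define \<theta> where "\<theta> = 1 - (t - s) / T"
    have \<theta>: "0 \<le> \<theta>" "\<theta> \<le> 1" using t T by (auto simp: \<theta>_def field_simps)
    \<comment> \<open>A convex combination of \<open>y\<close> and \<open>x s\<close>, plus the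
      displacement since time \<open>s\<close>: both summands are controlled by the sector
      estimates.\<close>
    have eq: "\<eta> t = (\<theta> *\<^sub>R y + (1 - \<theta>) *\<^sub>R x s) + (x t - x s)"
      unfolding \<eta>_def \<theta>_def[symmetric] \<delta>_def by (simp add: algebra_simps)
    note c = axial_radial_convex[OF y(1) escapes_fromD(1)[OF esc order_refl] y(2)
        escapes_fromD(3)[OF esc order_refl] \<theta>]
    have "s \<le> t" using t by simp
    note adv = escaping_advance[OF x s esc this]
    have ax: "\<rho> + (t - s) / 2 \<le> axial (\<eta> t)"
      unfolding eq axial_linear(1)[of "\<theta> *\<^sub>R y + (1 - \<theta>) *\<^sub>R x s"] using c adv by linarith
    have "radial (\<eta> t) \<le> \<kappa> * axial (\<theta> *\<^sub>R y + (1 - \<theta>) *\<^sub>R x s) + \<kappa> * axial (x t - x s)"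
      unfolding eq by (rule order_trans[OF radial_add add_mono[OF c(2) adv(2)]])
    also have "\<dots> = \<kappa> * axial (\<eta> t)"
      unfolding eq axial_linear(1)[of "\<theta> *\<^sub>R y + (1 - \<theta>) *\<^sub>R x s"] by (simp add: distrib_left)
    moreover have "0 < axial (\<eta> t)" using ax \<rho>_pos \<open>s \<le> t\<close> by argo
    ultimately show ?thesis using ax by (simp add: sector_def)
  qed
  have "u (\<eta> s) - u (\<eta> (s + T)) \<le> u (x s) - u (x (s + T)) + I"
  proof (rule calibrated_motion_competitor[OF dom x s, where \<eta>' = "\<lambda>t. v t - (1 / T) *\<^sub>R \<delta>" and f = f])
    show "s < s + T" using T by simp
    show "(\<eta> has_vector_derivative v t - (1 / T) *\<^sub>R \<delta>) (at t within {s..s + T})" if "t \<in> {s..s+T}" for t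
      unfolding \<eta>_def using calibrated_motionD(2)[OF x, of t] that s T
      by (auto intro!: derivative_eq_intros intro: has_vector_derivative_at_within)
    show "continuous_on {s..s + T} (\<lambda>t. v t - (1 / T) *\<^sub>R \<delta>)"
      using calibrated_motionD(7)[OF x] s by (intro continuous_intros continuous_at_imp_continuous_on) auto
    show "\<eta> t \<in> collision_free" if "t \<in> {s..s+T}" for t
      using \<eta>[OF that] sector_collision_free by blast
    show "lagrangian (speed\<^sup>2 / 2) (\<eta> t) (v t - (1 / T) *\<^sub>R \<delta>)
        \<le> lagrangian (speed\<^sup>2 / 2) (x t) (v t) + f t" if t: "t \<in> {s..s+T}" for t
    proof -
      have "s \<le> t" using t by simp
      have "(mass_norm m (v t - (1 / T) *\<^sub>R \<delta>))\<^sup>2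
          = (mass_norm m (v t))\<^sup>2 - 2 * (mass_inner m (v t) \<delta> / T) + ?N\<^sup>2 / T\<^sup>2"
        using T by (simp add: mass_norm_diff_square mass_inner_linear(7) mass_norm_scaleR power_divide power_mult_distrib)
      moreover have "- mass_inner m (v t) \<delta> / T \<le> (- mass_inner m a \<delta> + 2 * K / \<rho> * ?N) / T"
      proof (rule divide_right_mono)
        have "- mass_inner m (v t - a) \<delta> \<le> mass_norm m (v t - a) * ?N"
          using abs_mass_inner_le[of "v t - a" \<delta>] by linarith
        also have "\<dots> \<le> 2 * K / \<rho> * ?N"
          by (rule mult_right_mono[OF escaping_velocity(2)[OF x s esc \<open>s \<le> t\<close>]]) simp
        finally show "- mass_inner m (v t) \<delta> \<le> - mass_inner m a \<delta> + 2 * K / \<rho> * ?N"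
          by (simp add: mass_inner_linear(2))
      qed (use T in simp)
      moreover have "newton_potential m (\<eta> t) - newton_potential m (x t)
          \<le> K * ?N / ((\<rho> - s / 2) + t / 2)\<^sup>2"
      proof -
        have "newton_potential m (\<eta> t) - newton_potential m (x t)
            \<le> K * mass_norm m (\<eta> t - x t) / (\<rho> + (t - s) / 2)\<^sup>2"
        proof (rule potential_lip)
          show "0 < \<rho> + (t - s) / 2" using \<rho>_pos \<open>s \<le> t\<close> by argo
        qed (use \<eta>[OF t] escapes_fromD[OF esc \<open>s \<le> t\<close>] in auto)
        also have "mass_norm m (\<eta> t - x t) = \<bar>1 - (t - s) / T\<bar> * ?N"
          by (simp add: \<eta>_def mass_norm_scaleR)
        also have "K * (\<bar>1 - (t - s) / T\<bar> * ?N) / (\<rho> + (t - s) / 2)\<^sup>2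
            \<le> K * (1 * ?N) / (\<rho> + (t - s) / 2)\<^sup>2"
          using t T K_pos by (intro divide_right_mono mult_left_mono mult_right_mono) (auto simp: field_simps abs_le_iff)
        also have "\<rho> + (t - s) / 2 = (\<rho> - s / 2) + t / 2" by (simp add: field_simps)
        finally show ?thesis by simp
      qed
      moreover have "(- mass_inner m a \<delta> + 2 * K / \<rho> * ?N) / T
          = - mass_inner m a \<delta> / T + 2 * K / \<rho> * ?N / T"
        by (rule add_divide_distrib)
      moreover have "?N\<^sup>2 / (2 * T\<^sup>2) = ?N\<^sup>2 / T\<^sup>2 / 2" by simp
      moreover have "- mass_inner m (v t) \<delta> / T = - (mass_inner m (v t) \<delta> / T)" by simp
      ultimately show ?thesis
        unfolding lagrangian_def f_def by argo
    qed
    have "((\<lambda>t. K * ?N / ((\<rho> - s / 2) + t / 2)\<^sup>2) has_integral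
      (- (2 * (K * ?N) / ((\<rho> - s / 2) + (s + T) / 2)) - - (2 * (K * ?N) / ((\<rho> - s / 2) + s / 2)))) {s..s+T}"
    proof (rule fundamental_theorem_of_calculus)
      fix t assume "t \<in> {s..s + T}"
      then have "s \<le> t" by simp
      then have "\<rho> - s / 2 + t / 2 \<noteq> 0" using \<rho>_pos by argo
      then show "((\<lambda>t. - (2 * (K * ?N) / (\<rho> - s / 2 + t / 2))) has_vector_derivative
          K * ?N / (\<rho> - s / 2 + t / 2)\<^sup>2) (at t within {s..s + T})"
        by (rule has_vector_derivative_at_within[OF has_vector_derivative_reciprocal])
    qed (use T in simp)
    moreover have "((\<lambda>t. - mass_inner m a \<delta> / T + 2 * K / \<rho> * ?N / T + ?N\<^sup>2 / (2 * T\<^sup>2)) has_integral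
      (- mass_inner m a \<delta> / T + 2 * K / \<rho> * ?N / T + ?N\<^sup>2 / (2 * T\<^sup>2)) * (s + T - s)) {s..s+T}"
      using has_integral_const_real[of "- mass_inner m a \<delta> / T + 2 * K / \<rho> * ?N / T + ?N\<^sup>2 / (2 * T\<^sup>2)" s "s + T"] T
      by (simp add: mult.commute)
    ultimately show "(f has_integral I) {s..s + T}"
      unfolding f_def I_def by (intro has_integral_add)
  qed
  moreover have "\<eta> s = y" "\<eta> (s + T) = x (s + T)" using T by (simp_all add: \<eta>_def \<delta>_def)
  ultimately have "u y - u (x s) \<le> I" by simp
  \<comment> \<open>The value of the antiderivative at the late endpoint has a favourable sign and
    is dropped; the rest does not depend on \<open>s\<close>.\<close>
  also have "I \<le> (- mass_inner m a \<delta> / T + 2 * K / \<rho> * ?N / T + ?N\<^sup>2 / (2 * T\<^sup>2)) * T + 2 * (K * ?N) / \<rho>"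
  proof -
    have "0 \<le> \<rho> - s / 2 + (s + T) / 2" using T \<rho>_pos by argo
    then have "0 \<le> 2 * (K * ?N) / (\<rho> - s / 2 + (s + T) / 2)"
      using K_pos N by (intro divide_nonneg_nonneg) auto
    then show ?thesis by (simp add: I_def)
  qed
  also have "\<dots> = - mass_inner m a \<delta> + 2 * K / \<rho> * ?N + ?N\<^sup>2 / (2 * T) + 2 * (K * ?N) / \<rho>"
  proof -
    have "(X / T + Y / T + Z / (2 * T\<^sup>2)) * T = X + Y + Z / (2 * T)" for X Y Z
      using T by (simp add: field_simps power2_eq_square)
    then show ?thesis by (simp only:)
  qed
  also have "?N\<^sup>2 / (2 * T) = 1 / 2 * (?N / \<rho>)"
    using N \<rho>_pos by (simp add: T_def power2_eq_square)
  also have "- mass_inner m a \<delta> + 2 * K / \<rho> * ?N + 1 / 2 * (?N / \<rho>) + 2 * (K * ?N) / \<rho>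
      = - mass_inner m a \<delta> + (4 * K + 1 / 2) / \<rho> * ?N"
    by (simp add: add_divide_distrib distrib_right)
  also have "\<dots> \<le> - mass_inner m a \<delta> + (4 * K + 1) / \<rho> * ?N"
    using N \<rho>_pos by (intro add_left_mono mult_right_mono divide_right_mono) auto
  finally show ?thesis .
qed (simp add: \<delta>_def mass_inner_scale mass_scale_simps)

lemma start_region_sector: "x \<in> start_region \<Longrightarrow> x \<in> sector \<kappa> \<and> \<rho> \<le> axial x"
proof -
  assume x: "x \<in> start_region"
  then have "\<kappa> / 3 * axial x \<le> \<kappa> * axial x"
    using \<kappa>_pos \<rho>_pos by (intro mult_right_mono) (auto simp: start_region_def)
  then show ?thesis using x \<rho>_pos by (auto simp: start_region_def sector_def)
qed

text \<open>\<open>chord_bound\<close> and \<open>escape_shift_bound\<close> squeeze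
  \<open>u (x 0) - u (x s)\<close>, and after absorbing the error by \<open>\<rho>_action\<close>
  the displacement \<open>x s - x 0\<close> lies in the cone of aperture \<alpha>. Adding a vector
  of slope at most \<kappa>/4 to a starting point of slope below \<kappa>/3 keeps the slope below
  \<kappa>/3.\<close>

lemma no_turning_point:
  assumes dom: "dominated m (speed\<^sup>2 / 2) u" and u: "continuous_on UNIV u"
    and x: "calibrated_motion u x v w" and start: "x 0 \<in> start_region"
    and s: "0 < s" and esc: "escapes_from s x"
  shows "radial (x s) < \<kappa> / 2 * axial (x s)" "\<rho> < axial (x s)"
proof -
  let ?d = "x s - x 0"
  have "speed * mass_norm m (x 0 - x s) \<le> u (x 0) - u (x s)"
    by (rule chord_bound[OF x u s])
  also have "\<dots> \<le> - mass_inner m a (x 0 - x s) + (4 * K + 1) / \<rho> * mass_norm m (x 0 - x s)"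
    using escape_shift_bound[OF dom x s esc, of "x 0"] start_region_sector[OF start] by simp
  also have "\<dots> \<le> - mass_inner m a (x 0 - x s) + (1 - \<alpha>) * speed * mass_norm m (x 0 - x s)"
    using \<rho>_action \<rho>_pos by (intro add_left_mono mult_right_mono) (auto simp: divide_le_eq)
  finally have "\<alpha> * mass_norm m ?d * speed \<le> mass_inner m ?d a"
    by (simp add: mass_norm_minus_commute[of "x 0"] mass_inner_linear mass_inner_commute[of a] algebra_simps)
  then have d: "?d \<in> mass_cone m a \<alpha>" by (simp add: mass_cone_def speed_def[symmetric])
  have \<alpha>: "0 < \<alpha>" using \<alpha>_ge by simp
  have ax: "axial (x s) = axial (x 0) + axial ?d" by (simp add: axial_linear)
  show "\<rho> < axial (x s)"
    using ax mass_cone_radial(1)[OF d \<alpha>] start by (simp add: start_region_def)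
  have "radial (x s) \<le> radial (x 0) + radial ?d" using radial_add[of "x 0" ?d] by simp
  also have "\<dots> < \<kappa> / 3 * axial (x 0) + \<kappa> / 3 * axial ?d"
  proof (rule add_less_le_mono)
    show "radial (x 0) < \<kappa> / 3 * axial (x 0)" using start by (simp add: start_region_def)
    have "\<kappa> / 4 * axial ?d \<le> \<kappa> / 3 * axial ?d"
      using mass_cone_radial(1)[OF d \<alpha>] \<kappa>_pos by (intro mult_right_mono) auto
    then show "radial ?d \<le> \<kappa> / 3 * axial ?d" using mass_cone_narrow[OF d] by linarith
  qed
  also have "\<dots> = \<kappa> / 3 * axial (x s)" unfolding ax by (simp add: distrib_left)
  also have "\<dots> \<le> \<kappa> / 2 * axial (x s)"
    using \<kappa>_pos \<rho>_pos \<open>\<rho> < axial (x s)\<close> by (intro mult_right_mono) auto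
  finally show "radial (x s) < \<kappa> / 2 * axial (x s)" .
qed

lemma eventually_escapes:
  assumes x: "calibrated_motion u x v w"
  obtains s where "0 < s" "escapes_from s x"
proof -
  \<comment> \<open>This gives axial distance at least \<open>3 / 4 * t\<close> and radial distance
    at most \<open>\<kappa> / 4 * t\<close>, hence a slope below \<kappa>/2.\<close>
  define \<epsilon> where "\<epsilon> = min (speed / 4) (\<kappa> / 4)"
  have \<epsilon>: "0 < \<epsilon>" "\<epsilon> \<le> speed / 4" "\<epsilon> \<le> \<kappa> / 4" using speed_pos \<kappa>_pos by (auto simp: \<epsilon>_def)
  obtain s0 where s0: "\<And>t. s0 \<le> t \<Longrightarrow> mass_norm m (x t - t *\<^sub>R a) \<le> \<epsilon> * t"
    using calibrated_motionD(5)[OF x \<epsilon>(1)] by (auto simp: eventually_at_top_linorder)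
  \<comment> \<open>The entry \<open>2 * \<rho>\<close> makes \<open>\<rho> + (t - s) / 2\<close> at
    most \<open>t / 2\<close>.\<close>
  define s where "s = max s0 (2 * \<rho>)"
  have s: "s0 \<le> s" "2 * \<rho> \<le> s" by (auto simp: s_def)
  show thesis
  proof (rule that[of s])
    show "0 < s" using s \<rho>_pos by linarith
    show "escapes_from s x"
      unfolding escapes_from_def
    proof (intro allI impI)
      fix t assume "s \<le> t"
      then have t: "0 < t" "s0 \<le> t" "2 * \<rho> \<le> s" using s \<rho>_pos by linarith+
      let ?e = "x t - t *\<^sub>R a"
      have "- axial ?e \<le> mass_norm m ?e / speed" using abs_axial_le[of ?e] by linarith
      also have "\<dots> \<le> (speed / 4 * t) / speed"
        using order_trans[OF s0[OF t(2)] mult_right_mono[OF \<epsilon>(2)]] t(1) speed_pos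
        by (intro divide_right_mono) auto
      finally have ax: "3 / 4 * t \<le> axial (x t)" using speed_pos by (simp add: axial_linear)
      have "radial (x t) \<le> mass_norm m ?e" using radial_le[of ?e t] by simp
      also have "\<dots> \<le> \<kappa> / 4 * t"
        using s0[OF t(2)] mult_right_mono[OF \<epsilon>(3), of t] t(1) by linarith
      also have "\<dots> \<le> \<kappa> / 2 * (3 / 4 * t)" using \<kappa>_pos t(1) by simp
      also have "\<dots> \<le> \<kappa> / 2 * axial (x t)" using ax \<kappa>_pos by (intro mult_left_mono) auto
      finally show "radial (x t) \<le> \<kappa> / 2 * axial (x t) \<and> \<rho> + (t - s) / 2 \<le> axial (x t)"
        using ax t by (simp add: diff_divide_distrib)
    qed
  qed
qed

text \<open>A continuity argument on the infimum \<sigma> of the admissible escape times. If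
  \<sigma> were positive, the closed conditions would pass to \<sigma>,
  \<open>no_turning_point\<close> would make them strict there, and a slightly earlier time would
  still be admissible.\<close>

lemma escapes_from_start:
  assumes dom: "dominated m (speed\<^sup>2 / 2) u" and u: "continuous_on UNIV u"
    and x: "calibrated_motion u x v w" and start: "x 0 \<in> start_region" and "0 < t"
  shows "radial (x t) \<le> \<kappa> / 2 * axial (x t)" "\<rho> + t / 2 \<le> axial (x t)"
proof -
  define S where "S = {s. 0 < s \<and> escapes_from s x}"
  define \<sigma> where "\<sigma> = Inf S"
  have ne: "S \<noteq> {}" using eventually_escapes[OF x] by (auto simp: S_def)
  have bdd: "bdd_below S" by (auto simp: S_def intro!: bdd_belowI[of _ 0])
  have \<sigma>: "0 \<le> \<sigma>" unfolding \<sigma>_def using ne by (intro cInf_greatest) (auto simp: S_def)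
  \<comment> \<open>The infimum need not be attained at this stage; times of \<open>S\<close>
    approaching \<sigma> give the axial bound measured from \<sigma> itself.\<close>
  have after: "radial (x t) \<le> \<kappa> / 2 * axial (x t) \<and> \<rho> + (t - \<sigma>) / 2 \<le> axial (x t)" if "\<sigma> < t" for t
  proof -
    have near: "\<exists>s\<in>S. s < \<sigma> + \<epsilon>" if "0 < \<epsilon>" for \<epsilon>
      using cInf_lessD[OF ne, of "\<sigma> + \<epsilon>"] that by (auto simp: \<sigma>_def)
    have esc: "radial (x t) \<le> \<kappa> / 2 * axial (x t) \<and> \<rho> + (t - s) / 2 \<le> axial (x t)"
      if "s \<in> S" "s \<le> t" for s
      using that by (auto simp: S_def escapes_from_def)
    have "\<rho> + (t - \<sigma>) / 2 \<le> axial (x t) + \<epsilon>" if \<epsilon>: "0 < \<epsilon>" for \<epsilon>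
    proof -
      obtain s where s: "s \<in> S" "s < \<sigma> + min \<epsilon> (t - \<sigma>)"
        using near[of "min \<epsilon> (t - \<sigma>)"] \<epsilon> \<open>\<sigma> < t\<close> by auto
      then have "s \<le> t" "s < \<sigma> + \<epsilon>" by auto
      with esc[OF s(1)] \<epsilon> show ?thesis by argo
    qed
    then have "\<rho> + (t - \<sigma>) / 2 \<le> axial (x t)" by (rule field_le_epsilon)
    moreover obtain s where "s \<in> S" "s < \<sigma> + (t - \<sigma>)" using near[of "t - \<sigma>"] \<open>\<sigma> < t\<close> by auto
    ultimately show ?thesis using esc[of s] by simp
  qed
  have "\<sigma> = 0"
  proof (rule ccontr)
    assume "\<sigma> \<noteq> 0"
    then have pos: "0 < \<sigma>" using \<sigma> by simp
    have cont: "isCont x \<sigma>" by (rule calibrated_motionD(6)[OF x pos])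
    have ev: "eventually (\<lambda>t. \<sigma> < t) (at_right \<sigma>)" by (rule eventually_at_right_less)
    have "0 \<le> \<kappa> / 2 * axial (x \<sigma>) - radial (x \<sigma>)"
    proof (rule tendsto_lowerbound)
      have "isCont (\<lambda>t. \<kappa> / 2 * axial (x t) - radial (x t)) \<sigma>"
        by (intro continuous_intros isCont_axial isCont_radial cont)
      then show "((\<lambda>t. \<kappa> / 2 * axial (x t) - radial (x t)) \<longlongrightarrow> \<kappa> / 2 * axial (x \<sigma>) - radial (x \<sigma>)) (at_right \<sigma>)"
        unfolding isCont_def by (rule filterlim_mono[OF _ order_refl at_le]) simp
      show "\<forall>\<^sub>F t in at_right \<sigma>. 0 \<le> \<kappa> / 2 * axial (x t) - radial (x t)"
        using ev by eventually_elim (use after in auto)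
    qed simp
    moreover have "0 \<le> axial (x \<sigma>) - \<rho>"
    proof (rule tendsto_lowerbound)
      have "isCont (\<lambda>t. axial (x t) - \<rho>) \<sigma>"
        by (intro continuous_intros isCont_axial cont)
      then show "((\<lambda>t. axial (x t) - \<rho>) \<longlongrightarrow> axial (x \<sigma>) - \<rho>) (at_right \<sigma>)"
        unfolding isCont_def by (rule filterlim_mono[OF _ order_refl at_le]) simp
      show "\<forall>\<^sub>F t in at_right \<sigma>. 0 \<le> axial (x t) - \<rho>"
        using ev
      proof eventually_elim
        case (elim t)
        then show ?case using after[of t] by argo
      qed
    qed simp
    ultimately have esc: "escapes_from \<sigma> x"
      using after unfolding escapes_from_def by (auto simp: le_less)
    note strict = no_turning_point[OF dom u x start pos esc]
    define \<eta> where "\<eta> = (axial (x \<sigma>) - \<rho>) / 2"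
    have \<eta>: "0 < \<eta>" "\<rho> + \<eta> < axial (x \<sigma>)" using strict(2) by (auto simp: \<eta>_def field_simps)
    have lim: "(f \<longlongrightarrow> f \<sigma>) (nhds \<sigma>)" if "isCont f \<sigma>" for f :: "real \<Rightarrow> real"
      using that by (simp add: isCont_def tendsto_at_iff_tendsto_nhds)
    have "eventually (\<lambda>t. radial (x t) < \<kappa> / 2 * axial (x t)) (nhds \<sigma>)"
    proof -
      have "isCont (\<lambda>t. \<kappa> / 2 * axial (x t) - radial (x t)) \<sigma>"
        by (intro continuous_intros isCont_axial isCont_radial cont)
      from order_tendstoD(1)[OF lim[OF this], of 0] strict(1) show ?thesis by (auto elim: eventually_mono)
    qed
    moreover have "eventually (\<lambda>t. \<rho> + \<eta> < axial (x t)) (nhds \<sigma>)"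
      by (rule order_tendstoD(1)[OF lim[OF isCont_axial[OF cont]] \<eta>(2)])
    ultimately have "eventually (\<lambda>t. radial (x t) < \<kappa> / 2 * axial (x t) \<and> \<rho> + \<eta> < axial (x t)) (nhds \<sigma>)"
      by (rule eventually_conj)
    then obtain d where d: "0 < d"
      "\<And>t. dist t \<sigma> < d \<Longrightarrow> radial (x t) < \<kappa> / 2 * axial (x t) \<and> \<rho> + \<eta> < axial (x t)"
      unfolding eventually_nhds_metric by blast
    \<comment> \<open>The three entries keep \<open>s\<close> within the neighbourhood of radius
      \<open>d\<close>, keep it positive, and let the earlier origin of time raise the required
      axial distance by at most \<eta>.\<close>
    define s where "s = \<sigma> - min (min (d / 2) (\<sigma> / 2)) (2 * \<eta>)"
    have s: "0 < s" "s < \<sigma>" "\<sigma> - s < d" "(\<sigma> - s) / 2 \<le> \<eta>"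
      using d(1) pos \<eta>(1) by (auto simp: s_def min_def)
    have "escapes_from s x"
      unfolding escapes_from_def
    proof (intro allI impI)
      fix t assume "s \<le> t"
      show "radial (x t) \<le> \<kappa> / 2 * axial (x t) \<and> \<rho> + (t - s) / 2 \<le> axial (x t)"
      proof (cases "t \<le> \<sigma>")
        case True
        then have "dist t \<sigma> < d" using s \<open>s \<le> t\<close> by (simp add: dist_real_def)
        from d(2)[OF this] have "radial (x t) < \<kappa> / 2 * axial (x t)" "\<rho> + \<eta> < axial (x t)" by auto
        moreover have "(t - s) / 2 \<le> \<eta>" using True s(4) by argo
        ultimately show ?thesis by linarith
      next
        case False
        \<comment> \<open>After \<sigma> the axial gain is measured from \<open>x \<sigma>\<close>,
          whose surplus over \<rho> exceeds \<eta> and pays for starting the clock at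
          \<open>s\<close>.\<close>
        then have "\<sigma> \<le> t" by simp
        then have "(t - \<sigma>) / 2 \<le> axial (x t) - axial (x \<sigma>)"
          using escaping_advance(1)[OF x pos esc] by (simp add: axial_linear)
        then have "\<rho> + (t - s) / 2 \<le> axial (x t)" using s(4) \<eta>(2) by argo
        then show ?thesis using after[of t] False by simp
      qed
    qed
    then have "\<sigma> \<le> s" unfolding \<sigma>_def using bdd s(1) by (intro cInf_lower) (auto simp: S_def)
    then show False using s by simp
  qed
  then show "radial (x t) \<le> \<kappa> / 2 * axial (x t)" "\<rho> + t / 2 \<le> axial (x t)"
    using after[of t] \<open>0 < t\<close> by auto
qed

section \<open>Stability and first variation\<close>

text \<open>The condition \<open>escapes_from 0\<close> restricted to positive times, where the
  motion has a velocity.\<close>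

definition stays_out :: "(real \<Rightarrow> ('e, 'n) vec) \<Rightarrow> bool" where
  "stays_out x \<longleftrightarrow> (\<forall>t>0. radial (x t) \<le> \<kappa> / 2 * axial (x t) \<and> \<rho> + t / 2 \<le> axial (x t))"

lemma stays_outD:
  assumes "stays_out x" "0 < t"
  shows "x t \<in> sector \<kappa>" "\<rho> + t / 2 \<le> axial (x t)"
    "radial (x t) \<le> \<kappa> / 2 * axial (x t)" "\<rho> \<le> axial (x t)"
proof -
  show *: "\<rho> + t / 2 \<le> axial (x t)" "radial (x t) \<le> \<kappa> / 2 * axial (x t)"
    using assms by (auto simp: stays_out_def)
  then show "\<rho> \<le> axial (x t)" using assms(2) by argo
  then have pos: "0 < axial (x t)" using \<rho>_pos by linarith
  have "\<kappa> / 2 * axial (x t) \<le> \<kappa> * axial (x t)" using pos \<kappa>_pos by (intro mult_right_mono) auto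
  then show "x t \<in> sector \<kappa>" using * pos by (simp add: sector_def)
qed

lemma stays_out_velocity:
  assumes x: "calibrated_motion u x v w" "stays_out x" and "0 < t"
  shows "mass_norm m (v t - a) \<le> 2 * K / (\<rho> + t / 2)"
  using stays_outD[OF x(2)] \<rho>_pos \<open>0 < t\<close> by (intro velocity_limit[OF x(1) \<open>0 < t\<close>]) auto

text \<open>The data are given at both ends: initial positions, and equal limiting velocities at
  infinity. So the supremum \<open>B\<close> of the velocity differences is estimated by itself:
  \<open>B\<close> bounds the separation, hence the force difference, and integrating that back from
  infinity bounds \<open>B\<close> with a coefficient at most 1/2.\<close>

lemma velocity_stability:
  assumes x: "calibrated_motion u x v w" "stays_out x"
    and y: "calibrated_motion u y v' w'" "stays_out y" and "0 < t"
  shows "mass_norm m (v t - v' t) \<le> 4 * K / \<rho>\<^sup>2 * mass_norm m (x 0 - y 0)"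
proof -
  define B where "B = (SUP t\<in>{0<..}. mass_norm m (v t - v' t))"
  define z0 where "z0 = mass_norm m (x 0 - y 0)"
  have z0: "0 \<le> z0" by (simp add: z0_def)
  have diff: "mass_norm m (v t - v' t) \<le> 4 * K / (\<rho> + t / 2)" if "0 < t" for t
    using mass_norm_triangle_diff[of "v t - a" "v' t - a"]
      stays_out_velocity[OF x that] stays_out_velocity[OF y that] by simp
  have "mass_norm m (v t - v' t) \<le> 4 * K / \<rho>" if "0 < t" for t
  proof -
    have "4 * K / (\<rho> + t / 2) \<le> 4 * K / \<rho>" using K_pos \<rho>_pos that by (intro frac_le) auto
    then show ?thesis using diff[OF that] by linarith
  qed
  \<comment> \<open>Finiteness of the supremum comes first, since \<open>B\<close> is to be absorbed
    into the left side.\<close>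
  then have bdd: "bdd_above ((\<lambda>t. mass_norm m (v t - v' t)) ` {0<..})" by (auto intro!: bdd_aboveI2)
  have B: "mass_norm m (v t - v' t) \<le> B" if "0 < t" for t
    unfolding B_def using that bdd by (intro cSUP_upper) auto
  have B0: "0 \<le> B" using B[of 1] mass_norm_nonneg[of "v 1 - v' 1"] by linarith
  have dist: "mass_norm m (x t - y t) \<le> z0 + B * t" if "0 < t" for t
  proof -
    have "mass_norm m ((x t - y t) - (x 0 - y 0)) \<le> B * t - B * 0"
    proof (rule mass_norm_mean_value)
      show "continuous_on {0..t} (\<lambda>t. x t - y t)"
        by (intro continuous_intros calibrated_motionD(1)[OF x(1)] calibrated_motionD(1)[OF y(1)])
      show "((\<lambda>t. x t - y t) has_vector_derivative v r - v' r) (at r)" if "0 < r" for r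
        by (intro has_vector_derivative_diff calibrated_motionD(2)[OF x(1) that] calibrated_motionD(2)[OF y(1) that])
    qed (use that B in \<open>auto intro!: continuous_intros derivative_eq_intros\<close>)
    then show ?thesis
      using mass_norm_triangle[of "(x t - y t) - (x 0 - y 0)" "x 0 - y 0"] by (simp add: z0_def)
  qed
  \<comment> \<open>A constant with \<open>z0 + B * t \<le> Q * (\<rho> + t / 2)\<close>: the linear
    growth of the separation then cancels one power in the cubic decay of the force
    difference.\<close>
  define Q where "Q = z0 / \<rho> + 2 * B"
  have Q: "0 \<le> Q" using z0 B0 \<rho>_pos by (simp add: Q_def)
  have acc: "mass_norm m (w t - w' t) \<le> K * Q / (\<rho> + t / 2)\<^sup>2" if "0 < t" for t
  proof -
    let ?\<mu> = "\<rho> + t / 2"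
    have \<mu>: "0 < ?\<mu>" using \<rho>_pos that by simp
    have "z0 + B * t \<le> Q * ?\<mu>"
    proof -
      have "z0 + B * t \<le> z0 + B * t + (z0 / \<rho> * (t / 2) + 2 * B * \<rho>)"
        using z0 B0 \<rho>_pos that by simp
      also have "\<dots> = Q * ?\<mu>" using \<rho>_pos by (simp add: Q_def field_simps)
      finally show ?thesis .
    qed
    have "mass_norm m (w t - w' t) \<le> K * mass_norm m (x t - y t) / ?\<mu> ^ 3"
      using stays_outD[OF x(2) that] stays_outD[OF y(2) that] \<mu>
      by (intro acceleration_lip[OF x(1) y(1) that]) auto
    also have "\<dots> \<le> K * (Q * ?\<mu>) / ?\<mu> ^ 3"
      using dist[OF that] \<open>z0 + B * t \<le> Q * ?\<mu>\<close> K_pos \<mu>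
      by (intro divide_right_mono mult_left_mono) auto
    also have "\<dots> = K * Q / ?\<mu>\<^sup>2" using \<mu> by (simp add: power2_eq_square power3_eq_cube)
    finally show ?thesis .
  qed
  have bound: "mass_norm m (v t - v' t) \<le> 2 * (K * Q) / \<rho>" if "0 < t" for t
  proof (rule field_le_epsilon)
    fix \<epsilon> :: real assume \<epsilon>: "0 < \<epsilon>"
    \<comment> \<open>So late that both velocities are close to \<open>a\<close> and differ from
      each other by at most \<epsilon>.\<close>
    define r where "r = t + 8 * K / \<epsilon>"
    have r: "t \<le> r" "8 * K / \<epsilon> \<le> r" using \<epsilon> K_pos that by (auto simp: r_def)
    have "mass_norm m ((v r - v' r) - (v t - v' t))
        \<le> - (2 * (K * Q) / (\<rho> + r / 2)) - - (2 * (K * Q) / (\<rho> + t / 2))"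
    proof (rule mass_norm_mean_value[OF r(1)])
      show "continuous_on {t..r} (\<lambda>t. v t - v' t)"
        using that calibrated_motionD(7)[OF x(1)] calibrated_motionD(7)[OF y(1)]
        by (intro continuous_intros continuous_at_imp_continuous_on) auto
      show "continuous_on {t..r} (\<lambda>r. - (2 * (K * Q) / (\<rho> + r / 2)))"
        using that \<rho>_pos by (intro continuous_on_reciprocal) auto
      fix q assume q: "t < q" "q < r"
      then have "0 < q" using that by simp
      then show "((\<lambda>t. v t - v' t) has_vector_derivative w q - w' q) (at q)"
        by (intro has_vector_derivative_diff calibrated_motionD(3)[OF x(1)] calibrated_motionD(3)[OF y(1)])
      show "((\<lambda>r. - (2 * (K * Q) / (\<rho> + r / 2))) has_vector_derivative K * Q / (\<rho> + q / 2)\<^sup>2) (at q)"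
        using \<open>0 < q\<close> \<rho>_pos by (intro has_vector_derivative_reciprocal) auto
      show "mass_norm m (w q - w' q) \<le> K * Q / (\<rho> + q / 2)\<^sup>2" by (rule acc[OF \<open>0 < q\<close>])
    qed
    also have "\<dots> \<le> 2 * (K * Q) / \<rho>"
    proof -
      have "0 \<le> 2 * (K * Q) / (\<rho> + r / 2)"
        using K_pos Q \<rho>_pos r that by (intro divide_nonneg_nonneg) auto
      moreover have "2 * (K * Q) / (\<rho> + t / 2) \<le> 2 * (K * Q) / \<rho>"
        using K_pos Q \<rho>_pos that by (intro frac_le) auto
      ultimately show ?thesis by linarith
    qed
    finally have "mass_norm m ((v r - v' r) - (v t - v' t)) \<le> 2 * (K * Q) / \<rho>" .
    moreover have "mass_norm m (v r - v' r) \<le> \<epsilon>"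
    proof -
      have "8 * K \<le> r * \<epsilon>" using r(2) \<epsilon> by (simp add: divide_le_eq)
      moreover have "0 \<le> \<rho> * \<epsilon>" using \<rho>_pos \<epsilon> by simp
      ultimately have "4 * K / (\<rho> + r / 2) \<le> \<epsilon>"
        using \<rho>_pos r that by (simp add: divide_le_eq algebra_simps)
      then show ?thesis using diff[of r] r that by simp
    qed
    moreover have "mass_norm m (v t - v' t)
        \<le> mass_norm m (v r - v' r) + mass_norm m ((v r - v' r) - (v t - v' t))"
      using mass_norm_triangle_diff[of "v r - v' r" "(v r - v' r) - (v t - v' t)"] by simp
    ultimately show "mass_norm m (v t - v' t) \<le> 2 * (K * Q) / \<rho> + \<epsilon>" by linarith
  qed
  have "B \<le> 2 * (K * Q) / \<rho>"
    unfolding B_def using bound by (intro cSUP_least) auto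
  also have "\<dots> = 2 * K / \<rho>\<^sup>2 * z0 + 4 * K / \<rho> * B"
    by (simp add: Q_def distrib_left add_divide_distrib power2_eq_square)
  also have "\<dots> \<le> 2 * K / \<rho>\<^sup>2 * z0 + 1 / 2 * B"
    using \<rho>_stable \<rho>_pos B0 by (intro add_left_mono mult_right_mono) (auto simp: divide_le_eq)
  finally have "B \<le> 4 * K / \<rho>\<^sup>2 * z0" by simp
  then show ?thesis using B[OF \<open>0 < t\<close>] by (simp add: z0_def)
qed

text \<open>The translation \<delta> is undone linearly over unit time. By Newton's equation the
  first-order change of the action is an exact derivative and leaves only a boundary term in
  \<open>v s\<close>. The quadratic error consists of the kinetic 1/2 and the Taylor remainder at
  axial distance \<rho>/2, whose cube accounts for the factor 8.\<close>

lemma first_variation: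
  assumes dom: "dominated m (speed\<^sup>2 / 2) u" and x: "calibrated_motion u x v w" "stays_out x"
    and s: "0 < s" and \<delta>: "mass_norm m \<delta> * (1 + \<kappa> / speed) \<le> \<kappa> / 2 * \<rho>"
  shows "u (x s + \<delta>) - u (x s) \<le> - mass_inner m (v s) \<delta> + (1 / 2 + 8 * K / \<rho> ^ 3) * (mass_norm m \<delta>)\<^sup>2"
proof -
  let ?N = "mass_norm m \<delta>" and ?C = "1 / 2 + 8 * K / \<rho> ^ 3"
  define \<eta> where "\<eta> = (\<lambda>t. x t + (1 - (t - s)) *\<^sub>R \<delta>)"
  define f where "f = (\<lambda>t. - mass_inner m (v t) \<delta> + (1 - (t - s)) * potential_deriv m (x t) \<delta> + ?C * ?N\<^sup>2)"
  \<comment> \<open>Together these keep every partial translate of the motion in the sector of slope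
    \<kappa> at axial distance at least \<rho>/2.\<close>
  have small: "?N / speed \<le> \<rho> / 2" "?N + \<kappa> * (?N / speed) \<le> \<kappa> / 2 * \<rho>"
  proof -
    show *: "?N + \<kappa> * (?N / speed) \<le> \<kappa> / 2 * \<rho>" using \<delta> by (simp add: algebra_simps)
    have "\<kappa> * (?N / speed) \<le> \<kappa> * (\<rho> / 2)" using * mass_norm_nonneg[of \<delta>] by argo
    then show "?N / speed \<le> \<rho> / 2" by (rule mult_left_le_imp_le[OF _ \<kappa>_pos])
  qed
  have \<eta>: "\<eta> t \<in> sector \<kappa> \<and> \<rho> / 2 \<le> axial (\<eta> t)" if t: "t \<in> {s..s+1}" for t
  proof -
    let ?\<theta> = "1 - (t - s)"
    have "0 < t" and \<theta>: "0 \<le> ?\<theta>" "?\<theta> \<le> 1" using t s by auto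
    note out = stays_outD[OF x(2) \<open>0 < t\<close>]
    have "mass_norm m (?\<theta> *\<^sub>R \<delta>) \<le> 1 * ?N"
      unfolding mass_norm_scaleR using \<theta> by (intro mult_right_mono) auto
    then have e: "mass_norm m (?\<theta> *\<^sub>R \<delta>) \<le> ?N" by simp
    have ax: "axial (x t) - ?N / speed \<le> axial (\<eta> t)"
    proof -
      have "- axial (?\<theta> *\<^sub>R \<delta>) \<le> mass_norm m (?\<theta> *\<^sub>R \<delta>) / speed" using abs_axial_le[of "?\<theta> *\<^sub>R \<delta>"] by linarith
      also have "\<dots> \<le> ?N / speed" using e speed_pos by (intro divide_right_mono) auto
      finally show ?thesis by (simp add: \<eta>_def axial_linear(1))
    qed
    then have pos: "\<rho> / 2 \<le> axial (\<eta> t)" using out(4) small(1) by linarith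
    have "radial (\<eta> t) \<le> radial (x t) + radial (?\<theta> *\<^sub>R \<delta>)" unfolding \<eta>_def by (rule radial_add)
    also have "\<dots> \<le> \<kappa> / 2 * axial (x t) + ?N"
      using out(3) e radial_le[of "?\<theta> *\<^sub>R \<delta>" 0] by simp
    also have "\<dots> \<le> \<kappa> / 2 * axial (x t) + \<kappa> / 2 * axial (x t) - \<kappa> * (?N / speed)"
      using small(2) mult_left_mono[OF out(4), of "\<kappa> / 2"] \<kappa>_pos by linarith
    also have "\<dots> = \<kappa> * (axial (x t) - ?N / speed)" by (simp add: algebra_simps)
    also have "\<dots> \<le> \<kappa> * axial (\<eta> t)" using ax \<kappa>_pos by (intro mult_left_mono) auto
    finally show ?thesis using pos \<rho>_pos by (simp add: sector_def)
  qed
  have "u (\<eta> s) - u (\<eta> (s + 1)) \<le> u (x s) - u (x (s + 1)) + (- mass_inner m (v s) \<delta> + ?C * ?N\<^sup>2)"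
  proof (rule calibrated_motion_competitor[OF dom x(1) s, where \<eta>' = "\<lambda>t. v t - \<delta>" and f = f])
    show "(\<eta> has_vector_derivative v t - \<delta>) (at t within {s..s + 1})" if "t \<in> {s..s+1}" for t
      unfolding \<eta>_def using calibrated_motionD(2)[OF x(1), of t] that s
      by (auto intro!: derivative_eq_intros intro: has_vector_derivative_at_within)
    show "continuous_on {s..s + 1} (\<lambda>t. v t - \<delta>)"
      using calibrated_motionD(7)[OF x(1)] s by (intro continuous_intros continuous_at_imp_continuous_on) auto
    show "\<eta> t \<in> collision_free" if "t \<in> {s..s+1}" for t
      using \<eta>[OF that] sector_collision_free by blast
    show "lagrangian (speed\<^sup>2 / 2) (\<eta> t) (v t - \<delta>) \<le> lagrangian (speed\<^sup>2 / 2) (x t) (v t) + f t"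
      if t: "t \<in> {s..s+1}" for t
    proof -
      let ?\<theta> = "1 - (t - s)"
      have "0 < t" and \<theta>: "0 \<le> ?\<theta>" "?\<theta> \<le> 1" using t s by auto
      note out = stays_outD[OF x(2) \<open>0 < t\<close>]
      have "potential_deriv m (x t) (\<eta> t - x t) = ?\<theta> * potential_deriv m (x t) \<delta>"
        by (simp add: \<eta>_def calibrated_motionD(4)[OF x(1) \<open>0 < t\<close>, symmetric] mass_inner_linear(7))
      moreover have "newton_potential m (\<eta> t) - newton_potential m (x t) - potential_deriv m (x t) (\<eta> t - x t)
          \<le> K * (mass_norm m (x t - \<eta> t))\<^sup>2 / (\<rho> / 2) ^ 3"
        using \<eta>[OF t] out \<rho>_pos by (intro potential_taylor) auto
      moreover have "K * (mass_norm m (x t - \<eta> t))\<^sup>2 / (\<rho> / 2) ^ 3 \<le> 8 * K / \<rho> ^ 3 * ?N\<^sup>2"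
      proof -
        have "mass_norm m (x t - \<eta> t) = ?\<theta> * ?N"
          using \<theta> unfolding mass_norm_minus_commute[of "x t"] by (simp add: \<eta>_def mass_norm_scaleR)
        moreover have "?\<theta> * ?N \<le> 1 * ?N" using \<theta> by (intro mult_right_mono) auto
        ultimately have "mass_norm m (x t - \<eta> t) \<le> ?N" by simp
        then have "(mass_norm m (x t - \<eta> t))\<^sup>2 \<le> ?N\<^sup>2" by (rule power_mono) simp
        then have "K * (mass_norm m (x t - \<eta> t))\<^sup>2 / (\<rho> / 2) ^ 3 \<le> K * ?N\<^sup>2 / (\<rho> / 2) ^ 3"
          using K_pos \<rho>_pos by (intro divide_right_mono mult_left_mono) auto
        also have "\<dots> = 8 * K / \<rho> ^ 3 * ?N\<^sup>2" by (simp add: power_divide)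
        finally show ?thesis .
      qed
      ultimately have "newton_potential m (\<eta> t) - newton_potential m (x t)
          \<le> ?\<theta> * potential_deriv m (x t) \<delta> + 8 * K / \<rho> ^ 3 * ?N\<^sup>2" by linarith
      moreover have "?C * ?N\<^sup>2 = ?N\<^sup>2 / 2 + 8 * K / \<rho> ^ 3 * ?N\<^sup>2" by (simp add: distrib_right)
      \<comment> \<open>Pure arithmetic in place of the concrete terms: \<open>p\<close>,
        \<open>q\<close>, \<open>r\<close> stand for the square of \<open>v t\<close>, its product
        with \<delta> and the square of \<delta>; \<open>U\<close> and \<open>V\<close> for the two
        potentials; \<open>D\<close> for the linear term; \<open>E\<close> for the Taylor remainder;
        \<open>R\<close> for the whole quadratic error.\<close>
      moreover have "(p - 2 * q + r) / 2 + U + S \<le> p / 2 + V + S + (- q + D + R)"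
        if "U - V \<le> D + E" "R = r / 2 + E" for p q r U V S D E R :: real
        using that by argo
      ultimately show ?thesis
        unfolding lagrangian_def f_def mass_norm_diff_square[of "v t"] by blast
    qed
    \<comment> \<open>The product rule applies because the derivative of the momentum in direction
      \<delta> is the differential of the potential. The weight is 1 at \<open>s\<close> and 0 at
      \<open>s + 1\<close>, so only \<open>v s\<close> survives in the boundary terms.\<close>
    have "((\<lambda>t. (1 - (t - s)) * mass_inner m (v t) \<delta> + ?C * ?N\<^sup>2 * t) has_vector_derivative f t) (at t within {s..s+1})"
      if t: "t \<in> {s..s+1}" for t
    proof -
      have "0 < t" using t s by simp
      have "((\<lambda>t. mass_inner m (v t) \<delta>) has_vector_derivative mass_inner m (w t) \<delta>) (at t)"
        by (rule bounded_linear.has_vector_derivative[OF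
              bounded_bilinear.bounded_linear_left[OF bounded_bilinear_mass_inner] calibrated_motionD(3)[OF x(1) \<open>0 < t\<close>]])
      then have "((\<lambda>t. mass_inner m (v t) \<delta>) has_real_derivative potential_deriv m (x t) \<delta>) (at t)"
        by (simp add: has_real_derivative_iff_has_vector_derivative calibrated_motionD(4)[OF x(1) \<open>0 < t\<close>])
      then have "((\<lambda>t. (1 - (t - s)) * mass_inner m (v t) \<delta> + ?C * ?N\<^sup>2 * t) has_real_derivative f t) (at t)"
        unfolding f_def by (auto intro!: derivative_eq_intros)
      then show ?thesis
        by (simp add: has_real_derivative_iff_has_vector_derivative has_vector_derivative_at_within)
    qed
    then have "(f has_integral (((1 - ((s + 1) - s)) * mass_inner m (v (s + 1)) \<delta> + ?C * ?N\<^sup>2 * (s + 1))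
        - ((1 - (s - s)) * mass_inner m (v s) \<delta> + ?C * ?N\<^sup>2 * s))) {s..s+1}"
      by (intro fundamental_theorem_of_calculus) auto
    moreover have "((1 - ((s + 1) - s)) * mass_inner m (v (s + 1)) \<delta> + ?C * ?N\<^sup>2 * (s + 1))
        - ((1 - (s - s)) * mass_inner m (v s) \<delta> + ?C * ?N\<^sup>2 * s) = - mass_inner m (v s) \<delta> + ?C * ?N\<^sup>2"
      by (simp add: distrib_left)
    ultimately show "(f has_integral (- mass_inner m (v s) \<delta> + ?C * ?N\<^sup>2)) {s..s + 1}"
      by (simp only:)
  qed simp
  then show ?thesis by (simp add: \<eta>_def)
qed

section \<open>Differentiability on the open region of starting points\<close>

lemma open_start_region: "open start_region"
proof -
  have "open {x. radial x < \<kappa> / 3 * axial x}"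
    by (intro open_Collect_less continuous_intros continuous_on_radial continuous_on_axial)
  moreover have "open {x. \<rho> < axial x}"
    by (intro open_Collect_less continuous_intros continuous_on_axial)
  ultimately show ?thesis unfolding start_region_def by (simp add: Collect_conj_eq open_Int)
qed

lemma start_region_motion:
  assumes u: "u \<in> hyperbolic_viscosity_solutions m a" and y: "y \<in> start_region"
  obtains x v w where "calibrated_motion u x v w" "stays_out x" "x 0 = y"
proof -
  have dom: "dominated m (speed\<^sup>2 / 2) u" and cont: "continuous_on UNIV u"
    using u by (auto simp: hyperbolic_viscosity_solutions_def speed_def Let_def)
  obtain \<gamma> where \<gamma>: "\<gamma> 0 = y" "calibrates m (speed\<^sup>2 / 2) u {..0} \<gamma>"
    using u by (fastforce simp: hyperbolic_viscosity_solutions_def speed_def Let_def)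
  then have "is_hyperbolic_motion m a {0<..} (\<lambda>t. \<gamma> (- t))"
    using u by (auto simp: hyperbolic_viscosity_solutions_def speed_def Let_def)
  then obtain v w where x: "calibrated_motion u (\<lambda>t. \<gamma> (- t)) v w"
    using calibrated_motion_exists[OF \<gamma>(2)] by blast
  have "stays_out (\<lambda>t. \<gamma> (- t))"
    using escapes_from_start[OF dom cont x] y \<gamma>(1) by (auto simp: stays_out_def)
  then show thesis using that[OF x] \<gamma>(1) by simp
qed

text \<open>First variation at \<open>y\<close> bounds \<open>u (y + \<delta>) - u y\<close> from
  above. First variation at \<open>y + \<delta>\<close> with the opposite shift bounds it from
  below, in terms of another velocity that \<open>velocity_stability\<close> ties to the first one.
  Both bounds share a linear part and have quadratic errors.\<close>

lemma differentiable_on_start_region: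
  assumes u: "u \<in> hyperbolic_viscosity_solutions m a" and y: "y \<in> start_region"
  shows "u differentiable (at y)"
proof -
  have dom: "dominated m (speed\<^sup>2 / 2) u" and cont: "continuous_on UNIV u"
    using u by (auto simp: hyperbolic_viscosity_solutions_def speed_def Let_def)
  obtain x v w where x: "calibrated_motion u x v w" "stays_out x" "x 0 = y"
    using start_region_motion[OF u y] .
  define t where "t = (\<lambda>n. inverse (real (Suc n)))"
  have t: "0 < t n" "t n \<le> 1" for n by (auto simp: t_def field_simps)
  obtain c1 c2 where c: "0 < c1" "0 < c2"
    "\<And>x::('e, 'n) vec. mass_norm m x \<le> c1 * norm x" "\<And>x::('e, 'n) vec. norm x \<le> c2 * mass_norm m x"
    using mass_norm_equivalent by metis
  have "norm (v (t n)) \<le> c2 * (2 * K / \<rho> + speed)" for n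
  proof -
    have "2 * K / (\<rho> + t n / 2) \<le> 2 * K / \<rho>" using K_pos \<rho>_pos t[of n] by (intro frac_le) auto
    then have "mass_norm m (v (t n)) \<le> 2 * K / \<rho> + speed"
      using stays_out_velocity[OF x(1,2) t(1)[of n]] mass_norm_triangle[of "v (t n) - a" a]
      by (simp add: speed_def)
    then show ?thesis
      using c by (meson mult_left_mono less_imp_le order_trans)
  qed
  then have "bounded (range (\<lambda>n. v (t n)))" unfolding bounded_iff by blast
  then obtain p r where r: "strict_mono r" and p: "((\<lambda>n. v (t n)) \<circ> r) \<longlonglongrightarrow> p"
    using bounded_imp_convergent_subsequence by blast
  define q where "q = t \<circ> r"
  have q: "0 < q n" "q n \<le> 1" for n by (simp_all add: q_def t)
  have vq: "(\<lambda>n. v (q n)) \<longlonglongrightarrow> p" using p by (simp add: q_def o_def)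
  have "t \<longlonglongrightarrow> 0" unfolding t_def by (rule LIMSEQ_inverse_real_of_nat)
  then have q0: "q \<longlonglongrightarrow> 0" unfolding q_def by (rule LIMSEQ_subseq_LIMSEQ[OF _ r])
  have at0: "(\<lambda>n. x' (q n)) \<longlonglongrightarrow> x' 0" if "calibrated_motion u x' v' w'" for x' v' w'
    using continuous_on_tendsto_compose[OF calibrated_motionD(1)[OF that, of 1] q0] q
    by (auto simp: less_imp_le)
  have ulim: "(\<lambda>n. u (g n)) \<longlonglongrightarrow> u z" if "g \<longlonglongrightarrow> z" for g z
    using continuous_on_tendsto_compose[OF cont that] by simp
  let ?C = "1 / 2 + 8 * K / \<rho> ^ 3" and ?S = "4 * K / \<rho>\<^sup>2"
  have main: "\<bar>u (y + \<delta>) - u y - - mass_inner m p \<delta>\<bar> \<le> (?C + ?S) * (mass_norm m \<delta>)\<^sup>2"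
    if \<delta>: "mass_norm m \<delta> * (1 + \<kappa> / speed) \<le> \<kappa> / 2 * \<rho>" and y': "y + \<delta> \<in> start_region" for \<delta>
  proof -
    obtain x' v' w' where x': "calibrated_motion u x' v' w'" "stays_out x'" "x' 0 = y + \<delta>"
      using start_region_motion[OF u y'] .
    have vlim: "(\<lambda>n. mass_inner m (v (q n)) \<delta>) \<longlonglongrightarrow> mass_inner m p \<delta>"
      by (intro bounded_bilinear.tendsto[OF bounded_bilinear_mass_inner] vq tendsto_const)
    have up: "u (y + \<delta>) - u y \<le> - mass_inner m p \<delta> + ?C * (mass_norm m \<delta>)\<^sup>2"
    proof (rule LIMSEQ_le)
      show "(\<lambda>n. u (x (q n) + \<delta>) - u (x (q n))) \<longlonglongrightarrow> u (y + \<delta>) - u y"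
        using at0[OF x(1)] unfolding x(3) by (intro tendsto_diff ulim tendsto_add tendsto_const)
      show "(\<lambda>n. - mass_inner m (v (q n)) \<delta> + ?C * (mass_norm m \<delta>)\<^sup>2)
          \<longlonglongrightarrow> - mass_inner m p \<delta> + ?C * (mass_norm m \<delta>)\<^sup>2"
        by (intro tendsto_intros vlim)
      show "\<exists>N. \<forall>n\<ge>N. u (x (q n) + \<delta>) - u (x (q n)) \<le> - mass_inner m (v (q n)) \<delta> + ?C * (mass_norm m \<delta>)\<^sup>2"
        using first_variation[OF dom x(1,2) q(1) \<delta>] by blast
    qed
    \<comment> \<open>The velocity of the motion from \<open>y + \<delta>\<close> is replaced by
      that of the motion from \<open>y\<close>; their difference is of order \<delta> and is paired
      with \<delta>, whence the extra \<open>?S\<close>. Both are taken at the same times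
      \<open>q n\<close>.\<close>
    have down: "u y - u (y + \<delta>) \<le> mass_inner m p \<delta> + (?C + ?S) * (mass_norm m \<delta>)\<^sup>2"
    proof (rule LIMSEQ_le)
      have "(\<lambda>n. u (x' (q n) + - \<delta>) - u (x' (q n))) \<longlonglongrightarrow> u (y + \<delta> + - \<delta>) - u (y + \<delta>)"
        using at0[OF x'(1)] unfolding x'(3) by (intro tendsto_diff ulim tendsto_add tendsto_const)
      then show "(\<lambda>n. u (x' (q n) + - \<delta>) - u (x' (q n))) \<longlonglongrightarrow> u y - u (y + \<delta>)" by simp
      show "(\<lambda>n. mass_inner m (v (q n)) \<delta> + (?C + ?S) * (mass_norm m \<delta>)\<^sup>2)
          \<longlonglongrightarrow> mass_inner m p \<delta> + (?C + ?S) * (mass_norm m \<delta>)\<^sup>2"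
        by (intro tendsto_intros vlim)
      have "u (x' s + - \<delta>) - u (x' s) \<le> mass_inner m (v s) \<delta> + (?C + ?S) * (mass_norm m \<delta>)\<^sup>2" if "0 < s" for s
      proof -
        have "u (x' s + - \<delta>) - u (x' s) \<le> mass_inner m (v' s) \<delta> + ?C * (mass_norm m \<delta>)\<^sup>2"
          using first_variation[OF dom x'(1,2) that, of "- \<delta>"] \<delta> by (simp add: mass_inner_linear)
        also have "mass_inner m (v' s) \<delta> = mass_inner m (v s) \<delta> + mass_inner m (v' s - v s) \<delta>"
          by (simp add: mass_inner_linear)
        also have "mass_inner m (v' s - v s) \<delta> \<le> ?S * mass_norm m \<delta> * mass_norm m \<delta>"
        proof (rule order_trans[OF mass_inner_le mult_right_mono])
          show "mass_norm m (v' s - v s) \<le> ?S * mass_norm m \<delta>"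
            using velocity_stability[OF x'(1,2) x(1,2) that] by (simp add: x(3) x'(3))
        qed simp
        finally show ?thesis by (simp add: algebra_simps power2_eq_square)
      qed
      then show "\<exists>N. \<forall>n\<ge>N. u (x' (q n) + - \<delta>) - u (x' (q n))
          \<le> mass_inner m (v (q n)) \<delta> + (?C + ?S) * (mass_norm m \<delta>)\<^sup>2"
        using q(1) by blast
    qed
    have "0 \<le> ?S * (mass_norm m \<delta>)\<^sup>2" using K_pos by simp
    then show ?thesis using up down by (simp add: abs_le_iff algebra_simps)
  qed
  have "eventually (\<lambda>\<delta>. y + \<delta> \<in> start_region) (at 0)"
  proof (rule topological_tendstoD)
    have "((\<lambda>\<delta>. y + \<delta>) \<longlongrightarrow> y + 0) (at 0)" by (intro tendsto_intros)
    then show "((\<lambda>\<delta>. y + \<delta>) \<longlongrightarrow> y) (at 0)" by simp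
  qed (use open_start_region y in auto)
  moreover have "eventually (\<lambda>\<delta>::('e, 'n) vec. mass_norm m \<delta> * (1 + \<kappa> / speed) < \<kappa> / 2 * \<rho>) (at 0)"
  proof (rule order_tendstoD(2))
    have "((\<lambda>\<delta>::('e, 'n) vec. mass_norm m \<delta>) \<longlongrightarrow> mass_norm m (0::('e, 'n) vec)) (at 0)"
      using continuous_on_mass_norm[of UNIV] unfolding continuous_on_def by blast
    then have "((\<lambda>\<delta>::('e, 'n) vec. mass_norm m \<delta> * (1 + \<kappa> / speed)) \<longlongrightarrow> 0 * (1 + \<kappa> / speed)) (at 0)"
      by (intro tendsto_mult tendsto_const) simp
    then show "((\<lambda>\<delta>::('e, 'n) vec. mass_norm m \<delta> * (1 + \<kappa> / speed)) \<longlongrightarrow> 0) (at 0)" by simp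
  qed (use \<kappa>_pos \<rho>_pos in simp)
  ultimately have ev: "eventually (\<lambda>\<delta>. \<bar>u (y + \<delta>) - u y - - mass_inner m p \<delta>\<bar> \<le> (?C + ?S) * c1\<^sup>2 * (norm \<delta>)\<^sup>2) (at 0)"
  proof eventually_elim
    case (elim \<delta>)
    have "\<bar>u (y + \<delta>) - u y - - mass_inner m p \<delta>\<bar> \<le> (?C + ?S) * (mass_norm m \<delta>)\<^sup>2"
      using main[of \<delta>] elim by simp
    also have "\<dots> \<le> (?C + ?S) * (c1 * norm \<delta>)\<^sup>2"
      using c K_pos \<rho>_pos by (intro mult_left_mono power_mono) auto
    finally show ?case by (simp add: power_mult_distrib mult.assoc)
  qed
  have "bounded_linear (\<lambda>\<delta>. - mass_inner m p \<delta>)"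
    by (intro bounded_linear_minus bounded_bilinear.bounded_linear_right[OF bounded_bilinear_mass_inner])
  from has_derivative_quadratic_remainder[OF this ev] show ?thesis
    unfolding differentiable_def by blast
qed

lemma cutted_cone_subset_start_region: "cutted_cone m a \<alpha> (4 * \<rho> * speed) \<subseteq> start_region"
proof
  fix x assume "x \<in> cutted_cone m a \<alpha> (4 * \<rho> * speed)"
  then have x: "x \<in> mass_cone m a \<alpha>" "4 * \<rho> * speed \<le> mass_norm m x" by (auto simp: cutted_cone_def)
  \<comment> \<open>Since \<alpha> is at least 1/2, the cut radius forces axial distance at least
    \<open>2 * \<rho>\<close>, strictly more than the required \<rho>.\<close>
  have "1 / 2 * (4 * \<rho> * speed) \<le> \<alpha> * mass_norm m x"
    using x(2) \<alpha>_ge \<rho>_pos speed_pos by (intro mult_mono) auto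
  also have "\<dots> \<le> speed * axial x" using mass_cone_radial(3)[OF x(1)] \<alpha>_ge by simp
  finally have "2 * \<rho> \<le> axial x" using speed_pos by (simp add: mult.commute)
  moreover have "radial x \<le> \<kappa> / 4 * axial x" by (rule mass_cone_narrow[OF x(1)])
  moreover have "\<kappa> / 4 * axial x < \<kappa> / 3 * axial x"
    using \<open>2 * \<rho> \<le> axial x\<close> \<rho>_pos \<kappa>_pos by (intro mult_strict_right_mono) auto
  ultimately show "x \<in> start_region" using \<rho>_pos unfolding start_region_def by auto
qed

end

section \<open>Choice of the aperture and of the cut radius\<close>

theorem corollary3p1:
  fixes m :: "'n::{finite,linorder} \<Rightarrow> real"
    and a :: "('e::euclidean_space, 'n) vec"
  assumes "DIM('e) \<ge> 2"
    and "CARD('n) \<ge> 2"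
    and "\<forall>i. m i > 0"
    and "a \<in> collision_free"
  shows "\<exists>\<alpha> r. 0 < \<alpha> \<and> \<alpha> < 1 \<and> 0 < r \<and>
    (\<forall>u\<in>hyperbolic_viscosity_solutions m a. \<forall>x\<in>cutted_cone m a \<alpha> r. u differentiable (at x))"
proof -
  interpret newton_shape m a
    using assms by unfold_locales auto
  obtain \<kappa> K where "newton_sector m a \<kappa> K"
    by (rule sector_estimates)
  then interpret newton_sector m a \<kappa> K .
  \<comment> \<open>The number \<open>q\<close> is the value of
    \<open>1 / \<alpha>\<^sup>2 - 1\<close>, the squared tangent of the half-angle: the cap 3 gives
    \<open>1 / 2 \<le> \<alpha>\<close>, and the other entry gives slope at most \<kappa>/4.\<close>
  define q where "q = min 3 ((\<kappa> / 4)\<^sup>2 / speed\<^sup>2)"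
  define \<alpha> where "\<alpha> = 1 / sqrt (1 + q)"
  \<comment> \<open>The entries secure \<open>\<rho>_action\<close>, \<open>\<rho>_sector\<close>
    and \<open>\<rho>_stable\<close>, in this order; the last also makes \<rho> positive. None of
    them involves \<open>u\<close>, so one cone serves all solutions.\<close>
  define \<rho> where "\<rho> = max (max ((4 * K + 1) / ((1 - \<alpha>) * speed)) (4 * K / \<kappa>)) (8 * K)"
  have q: "0 < q" "q \<le> 3" "q \<le> (\<kappa> / 4)\<^sup>2 / speed\<^sup>2"
    using \<kappa>_pos speed_pos by (auto simp: q_def)
  have \<alpha>: "1 / 2 \<le> \<alpha>" "\<alpha> < 1"
  proof -
    have "sqrt (1 + q) \<le> 2" using q by (intro real_le_lsqrt) auto
    then show "1 / 2 \<le> \<alpha>" using q by (simp add: \<alpha>_def field_simps)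
    show "\<alpha> < 1" using q by (simp add: \<alpha>_def)
  qed
  have \<rho>: "(4 * K + 1) / ((1 - \<alpha>) * speed) \<le> \<rho>" "4 * K / \<kappa> \<le> \<rho>" "8 * K \<le> \<rho>"
    by (simp_all add: \<rho>_def)
  interpret escape_region m a \<kappa> K \<alpha> \<rho>
  proof unfold_locales
    have "1 / \<alpha>\<^sup>2 - 1 = q" using q by (simp add: \<alpha>_def power_divide)
    then show "speed\<^sup>2 * (1 / \<alpha>\<^sup>2 - 1) \<le> (\<kappa> / 4)\<^sup>2"
      using q(3) speed_pos by (simp add: field_simps)
    show "0 < \<rho>" using \<rho>(3) K_pos by linarith
    show "4 * K + 1 \<le> (1 - \<alpha>) * speed * \<rho>"
      using \<rho>(1) \<alpha>(2) speed_pos by (simp add: divide_le_eq mult.commute)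
    show "4 * K \<le> \<kappa> * \<rho>" using \<rho>(2) \<kappa>_pos by (simp add: divide_le_eq mult.commute)
  qed (use \<alpha> \<rho> in auto)
  show ?thesis
  proof (intro exI conjI ballI)
    show "0 < \<alpha>" "\<alpha> < 1" using \<alpha> by auto
    show "0 < 4 * \<rho> * speed" using \<rho>_pos speed_pos by simp
    show "u differentiable (at x)"
      if "u \<in> hyperbolic_viscosity_solutions m a" "x \<in> cutted_cone m a \<alpha> (4 * \<rho> * speed)" for u x
      using differentiable_on_start_region[OF that(1)] cutted_cone_subset_start_region that(2) by blast
  qed
qed

end
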